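(* Every module SRF $(M,g,\mathcal{F})$ is a geometric SRF.
   Context: A singular foliation (SF) on a smooth manifold $M$ is a $C^\infty(M)$-submodule $\mathcal{F}$ of the compactly supported vector fields $\mathfrak{X}_c(M)$ that is closed under the Lie bracket and locally finitely generated: every $q\in M$ has an open neighborhood $U$ such that $\{X\in\mathcal{F}:\mathrm{supp}(X)\subset U\}=\langle X_1,\dots,X_N\rangle_{C_c^\infty(U)}$ for finitely many $X_a\in\mathfrak{X}(U)$. An SF partitions $M$ into connected injectively immersed submanifolds called leaves; the tangent space at $q$ of the leaf through $q$ is $F_q=\{X|_q:X\in\mathcal{F}\}$. Let $(M,g)$ be a Riemannian manifold and $\mathcal{F}$ an SF on $M$. $(M,g,\mathcal{F})$ is a module SRF if $\mathcal{L}_Xg\in\Omega^1(M)\odot g_\flat(\mathcal{F})$ for every $X\in\mathcal{F}$, where $g_\flat(Y)=g(Y,\cdot)$, $\odot$ is the symmetric tensor product, and the right-hand side consists of finite sums of elements $\omega\odot g_\flat(Y)$ with $\omega\in\Omega^1(M)$, $Y\in\mathcal{F}$. $(M,g,\mathcal{F})$ is a geometric SRF if every geodesic orthogonal to a leaf at one point is orthogonal to all the leaves it meets (i.e. if $\dot\gamma(t_0)\perp F_{\gamma(t_0)}$ for some $t_0$, then $\dot\gamma(t)\perp F_{\gamma(t)}$ for all $t$ in the domain of the geodesic $\gamma$). *)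

theory Defs
  imports "HOL-Analysis.Analysis"
begin

section \<open>Smooth maps between open subsets of normed spaces\<close>

text \<open>Only meant for open \<open>S\<close>.\<close>

primrec C_k_on :: "nat \<Rightarrow> 'x::real_normed_vector set \<Rightarrow> ('x \<Rightarrow> 'y::real_normed_vector) \<Rightarrow> bool" where
  "C_k_on 0 S f \<longleftrightarrow> continuous_on S f"
| "C_k_on (Suc k) S f \<longleftrightarrow>
     (\<forall>x\<in>S. f differentiable (at x)) \<and> (\<forall>v. C_k_on k S (\<lambda>x. frechet_derivative f (at x) v))"

definition smooth_on :: "'x::real_normed_vector set \<Rightarrow> ('x \<Rightarrow> 'y::real_normed_vector) \<Rightarrow> bool" where
  "smooth_on S f \<longleftrightarrow> (\<forall>k. C_k_on k S f)"


section \<open>Smooth manifolds\<close>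

text \<open>
  A manifold is a Hausdorff second countable type \<open>'a\<close> together with a smooth atlas with values in
  a model space \<open>'e\<close>.  The sort \<open>{real_inner, heine_borel}\<close> of the model space describes the
  finite-dimensional inner product spaces: by Riesz, a normed space in which bounded closed sets
  are compact is finite-dimensional.  In contrast to \<open>euclidean_space\<close> it admits dimension 0.
  A chart is a pair of its domain and its coordinate map.
\<close>

type_synonym ('a, 'e) chart = "'a set \<times> ('a \<Rightarrow> 'e)"

abbreviation cdom :: "('a, 'e) chart \<Rightarrow> 'a set" where
  "cdom c \<equiv> fst c"

abbreviation cmap :: "('a, 'e) chart \<Rightarrow> 'a \<Rightarrow> 'e" where
  "cmap c \<equiv> snd c"

abbreviation cran :: "('a, 'e) chart \<Rightarrow> 'e set" where
  "cran c \<equiv> cmap c ` cdom c"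

definition cinv :: "('a, 'e) chart \<Rightarrow> 'e \<Rightarrow> 'a" where
  "cinv c = inv_into (cdom c) (cmap c)"

definition smooth_atlas ::
    "('a::{t2_space, second_countable_topology}, 'e::{real_inner, heine_borel}) chart set \<Rightarrow> bool" where
  "smooth_atlas A \<longleftrightarrow>
     (\<Union>c\<in>A. cdom c) = UNIV \<and>
     (\<forall>c\<in>A. open (cdom c) \<and> open (cran c) \<and> homeomorphism (cdom c) (cran c) (cmap c) (cinv c)) \<and>
     (\<forall>c\<in>A. \<forall>d\<in>A. smooth_on (cmap c ` (cdom c \<inter> cdom d)) (cmap d \<circ> cinv c))"

text \<open>Some chart around \<open>q\<close>; only used for chart-independent expressions.\<close>

definition chart_at :: "('a, 'e) chart set \<Rightarrow> 'a \<Rightarrow> ('a, 'e) chart" where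
  "chart_at A q = (SOME c. c \<in> A \<and> q \<in> cdom c)"

definition smooth_functions ::
    "('a::{t2_space, second_countable_topology}, 'e::{real_inner, heine_borel}) chart set
      \<Rightarrow> ('a \<Rightarrow> real) set" where
  "smooth_functions A = {f. \<forall>c\<in>A. smooth_on (cran c) (\<lambda>x. f (cinv c x))}"

text \<open>
  Functions in \<open>C\<^sub>c\<^sup>\<infinity>(U)\<close>, for open \<open>U\<close>, are identified with their extensions by 0 to
  the whole manifold.
\<close>

definition compactly_supported_functions ::
    "('a::{t2_space, second_countable_topology}, 'e::{real_inner, heine_borel}) chart set
      \<Rightarrow> 'a set \<Rightarrow> ('a \<Rightarrow> real) set" where
  "compactly_supported_functions A U =
     {f \<in> smooth_functions A. compact (closure {q. f q \<noteq> 0}) \<and> closure {q. f q \<noteq> 0} \<subseteq> U}"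


section \<open>Tangent vectors and vector fields\<close>

text \<open>
  A tangent vector at \<open>q\<close> assigns to each chart around \<open>q\<close> a vector of the model space (its
  components in that chart), such that components in different charts are related by the
  derivative of the transition map.  The value at all other charts is set to 0, so that tangent
  vectors are equal iff all their components are.
\<close>

type_synonym ('a, 'e) tvector = "('a, 'e) chart \<Rightarrow> 'e"

type_synonym ('a, 'e) vfield = "'a \<Rightarrow> ('a, 'e) tvector"

definition tangent_space ::
    "('a::{t2_space, second_countable_topology}, 'e::{real_inner, heine_borel}) chart set
      \<Rightarrow> 'a \<Rightarrow> ('a, 'e) tvector set" where
  "tangent_space A q =
     {v. (\<forall>c. \<not> (c \<in> A \<and> q \<in> cdom c) \<longrightarrow> v c = 0) \<and>
         (\<forall>c\<in>A. \<forall>d\<in>A. q \<in> cdom c \<inter> cdom d \<longrightarrow>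
            v d = frechet_derivative (cmap d \<circ> cinv c) (at (cmap c q)) (v c))}"

text \<open>The tangent vector at \<open>q\<close> with components \<open>u\<close> in the chart \<open>c\<close>.\<close>

definition tvec ::
    "('a::{t2_space, second_countable_topology}, 'e::{real_inner, heine_borel}) chart set
      \<Rightarrow> ('a, 'e) chart \<Rightarrow> 'a \<Rightarrow> 'e \<Rightarrow> ('a, 'e) tvector" where
  "tvec A c q u =
     (\<lambda>d. if d \<in> A \<and> q \<in> cdom d then frechet_derivative (cmap d \<circ> cinv c) (at (cmap c q)) u else 0)"

text \<open>\<open>\<XX>(U)\<close> for open \<open>U\<close>; the values outside of \<open>U\<close> are irrelevant.\<close>

definition vector_fields_on ::
    "('a::{t2_space, second_countable_topology}, 'e::{real_inner, heine_borel}) chart set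
      \<Rightarrow> 'a set \<Rightarrow> ('a, 'e) vfield set" where
  "vector_fields_on A U =
     {X. (\<forall>q\<in>U. X q \<in> tangent_space A q) \<and>
         (\<forall>c\<in>A. smooth_on (cmap c ` (cdom c \<inter> U)) (\<lambda>x. X (cinv c x) c))}"

abbreviation vector_fields ::
    "('a::{t2_space, second_countable_topology}, 'e::{real_inner, heine_borel}) chart set
      \<Rightarrow> ('a, 'e) vfield set" where
  "vector_fields A \<equiv> vector_fields_on A UNIV"

definition vsupport :: "('a::topological_space, 'e::zero) vfield \<Rightarrow> 'a set" where
  "vsupport X = closure {q. X q \<noteq> (\<lambda>c. 0)}"

definition compactly_supported_vector_fields ::
    "('a::{t2_space, second_countable_topology}, 'e::{real_inner, heine_borel}) chart set
      \<Rightarrow> ('a, 'e) vfield set" where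
  "compactly_supported_vector_fields A = {X \<in> vector_fields A. compact (vsupport X)}"

text \<open>In coordinates \<open>[X, Y]\<^sup>i = X\<^sup>j \<partial>\<^sub>j Y\<^sup>i - Y\<^sup>j \<partial>\<^sub>j X\<^sup>i\<close>.\<close>

definition lie_bracket ::
    "('a::{t2_space, second_countable_topology}, 'e::{real_inner, heine_borel}) chart set
      \<Rightarrow> ('a, 'e) vfield \<Rightarrow> ('a, 'e) vfield \<Rightarrow> ('a, 'e) vfield" where
  "lie_bracket A X Y =
     (\<lambda>q c. if c \<in> A \<and> q \<in> cdom c
        then frechet_derivative (\<lambda>x. Y (cinv c x) c) (at (cmap c q)) (X q c)
           - frechet_derivative (\<lambda>x. X (cinv c x) c) (at (cmap c q)) (Y q c)
        else 0)"

text \<open>The derivative \<open>df\<^sub>q(v)\<close> of a function \<open>f\<close> in the direction of a tangent vector \<open>v\<close> at \<open>q\<close>.\<close>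

definition directional_derivative ::
    "('a::{t2_space, second_countable_topology}, 'e::{real_inner, heine_borel}) chart set
      \<Rightarrow> ('a \<Rightarrow> real) \<Rightarrow> 'a \<Rightarrow> ('a, 'e) tvector \<Rightarrow> real" where
  "directional_derivative A f q v =
     (let c = chart_at A q in frechet_derivative (\<lambda>x. f (cinv c x)) (at (cmap c q)) (v c))"


section \<open>One-forms and Riemannian metrics\<close>

text \<open>Values of forms and metrics at arguments that are not tangent vectors at \<open>q\<close> are irrelevant.\<close>

type_synonym ('a, 'e) covector_field = "'a \<Rightarrow> ('a, 'e) tvector \<Rightarrow> real"

type_synonym ('a, 'e) bilinear_field = "'a \<Rightarrow> ('a, 'e) tvector \<Rightarrow> ('a, 'e) tvector \<Rightarrow> real"

definition one_forms ::
    "('a::{t2_space, second_countable_topology}, 'e::{real_inner, heine_borel}) chart set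
      \<Rightarrow> ('a, 'e) covector_field set" where
  "one_forms A =
     {\<omega>. (\<forall>q. \<forall>v\<in>tangent_space A q. \<forall>w\<in>tangent_space A q. \<forall>a b.
            \<omega> q (\<lambda>c. a *\<^sub>R v c + b *\<^sub>R w c) = a * \<omega> q v + b * \<omega> q w) \<and>
         (\<forall>c\<in>A. \<forall>u. smooth_on (cran c) (\<lambda>x. \<omega> (cinv c x) (tvec A c (cinv c x) u)))}"

text \<open>The coordinate expression of a metric in the chart \<open>c\<close>, at a point \<open>x\<close> of \<open>cran c\<close>.\<close>

definition metric_in_chart ::
    "('a::{t2_space, second_countable_topology}, 'e::{real_inner, heine_borel}) chart set
      \<Rightarrow> ('a, 'e) bilinear_field \<Rightarrow> ('a, 'e) chart \<Rightarrow> 'e \<Rightarrow> 'e \<Rightarrow> 'e \<Rightarrow> real" where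
  "metric_in_chart A g c x u w = g (cinv c x) (tvec A c (cinv c x) u) (tvec A c (cinv c x) w)"

definition riemannian_metric ::
    "('a::{t2_space, second_countable_topology}, 'e::{real_inner, heine_borel}) chart set
      \<Rightarrow> ('a, 'e) bilinear_field \<Rightarrow> bool" where
  "riemannian_metric A g \<longleftrightarrow>
     (\<forall>q. \<forall>u\<in>tangent_space A q. \<forall>v\<in>tangent_space A q. \<forall>w\<in>tangent_space A q. \<forall>a b.
        g q (\<lambda>c. a *\<^sub>R u c + b *\<^sub>R v c) w = a * g q u w + b * g q v w) \<and>
     (\<forall>q. \<forall>v\<in>tangent_space A q. \<forall>w\<in>tangent_space A q. g q v w = g q w v) \<and>
     (\<forall>q. \<forall>v\<in>tangent_space A q. v \<noteq> (\<lambda>c. 0) \<longrightarrow> g q v v > 0) \<and>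
     (\<forall>c\<in>A. \<forall>u w. smooth_on (cran c) (\<lambda>x. metric_in_chart A g c x u w))"

definition flat ::
    "('a, 'e) bilinear_field \<Rightarrow> ('a, 'e) vfield \<Rightarrow> ('a, 'e) covector_field" where
  "flat g Y = (\<lambda>q. g q (Y q))"

text \<open>The normalization of the symmetric product does not matter below.\<close>

definition sym_product ::
    "('a, 'e) covector_field \<Rightarrow> ('a, 'e) covector_field \<Rightarrow> ('a, 'e) bilinear_field" where
  "sym_product \<omega> \<eta> = (\<lambda>q v w. (\<omega> q v * \<eta> q w + \<omega> q w * \<eta> q v) / 2)"

text \<open>\<open>(\<L>\<^sub>X g)(V, W) = X(g(V, W)) - g([X, V], W) - g(V, [X, W])\<close>.\<close>

definition lie_derivative_metric ::
    "('a::{t2_space, second_countable_topology}, 'e::{real_inner, heine_borel}) chart set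
      \<Rightarrow> ('a, 'e) vfield \<Rightarrow> ('a, 'e) bilinear_field
      \<Rightarrow> ('a, 'e) vfield \<Rightarrow> ('a, 'e) vfield \<Rightarrow> 'a \<Rightarrow> real" where
  "lie_derivative_metric A X g V W =
     (\<lambda>q. directional_derivative A (\<lambda>p. g p (V p) (W p)) q (X q)
        - g q (lie_bracket A X V q) (W q)
        - g q (V q) (lie_bracket A X W q))"


section \<open>Geodesics\<close>

text \<open>
  The Christoffel symbols \<open>\<Gamma>(u, w)\<^sup>k = \<Gamma>\<^sup>k\<^sub>i\<^sub>j u\<^sup>i w\<^sup>j\<close> of the Levi-Civita connection in the chart \<open>c\<close>,
  determined by
  \<open>g(\<Gamma>(u, w), v) = (\<partial>\<^sub>u g(w, v) + \<partial>\<^sub>w g(u, v) - \<partial>\<^sub>v g(u, w)) / 2\<close>.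
\<close>

definition christoffel ::
    "('a::{t2_space, second_countable_topology}, 'e::{real_inner, heine_borel}) chart set
      \<Rightarrow> ('a, 'e) bilinear_field \<Rightarrow> ('a, 'e) chart \<Rightarrow> 'e \<Rightarrow> 'e \<Rightarrow> 'e \<Rightarrow> 'e" where
  "christoffel A g c x u w =
     (THE z. \<forall>v. metric_in_chart A g c x z v =
        (frechet_derivative (\<lambda>y. metric_in_chart A g c y w v) (at x) u
       + frechet_derivative (\<lambda>y. metric_in_chart A g c y u v) (at x) w
       - frechet_derivative (\<lambda>y. metric_in_chart A g c y u w) (at x) v) / 2)"

definition velocity ::
    "('a::{t2_space, second_countable_topology}, 'e::{real_inner, heine_borel}) chart set
      \<Rightarrow> real set \<Rightarrow> (real \<Rightarrow> 'a) \<Rightarrow> real \<Rightarrow> ('a, 'e) tvector" where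
  "velocity A I \<gamma> t =
     (\<lambda>c. if c \<in> A \<and> \<gamma> t \<in> cdom c
        then vector_derivative (\<lambda>s. cmap c (\<gamma> s)) (at t within I) else 0)"

text \<open>
  The domain \<open>I\<close> is any nondegenerate interval, with one-sided derivatives at end points that belong
  to it.  In each chart the geodesic equation is \<open>x'' = - \<Gamma>(x', x')\<close>; it implies that twice
  differentiable solutions are smooth.
\<close>

definition geodesic ::
    "('a::{t2_space, second_countable_topology}, 'e::{real_inner, heine_borel}) chart set
      \<Rightarrow> ('a, 'e) bilinear_field \<Rightarrow> real set \<Rightarrow> (real \<Rightarrow> 'a) \<Rightarrow> bool" where
  "geodesic A g I \<gamma> \<longleftrightarrow>
     is_interval I \<and> interior I \<noteq> {} \<and> continuous_on I \<gamma> \<and>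
     (\<forall>c\<in>A. \<forall>t\<in>I. \<gamma> t \<in> cdom c \<longrightarrow>
        ((\<lambda>s. cmap c (\<gamma> s)) has_vector_derivative velocity A I \<gamma> t c) (at t within I) \<and>
        ((\<lambda>s. velocity A I \<gamma> s c) has_vector_derivative
           - christoffel A g c (cmap c (\<gamma> t)) (velocity A I \<gamma> t c) (velocity A I \<gamma> t c))
          (at t within I))"


section \<open>Singular foliations and singular Riemannian foliations\<close>

definition singular_foliation ::
    "('a::{t2_space, second_countable_topology}, 'e::{real_inner, heine_borel}) chart set
      \<Rightarrow> ('a, 'e) vfield set \<Rightarrow> bool" where
  "singular_foliation A F \<longleftrightarrow>
     F \<subseteq> compactly_supported_vector_fields A \<and>
     (\<lambda>q c. 0) \<in> F \<and>
     (\<forall>X\<in>F. \<forall>Y\<in>F. (\<lambda>q c. X q c + Y q c) \<in> F) \<and>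
     (\<forall>f\<in>smooth_functions A. \<forall>X\<in>F. (\<lambda>q c. f q *\<^sub>R X q c) \<in> F) \<and>
     (\<forall>X\<in>F. \<forall>Y\<in>F. lie_bracket A X Y \<in> F) \<and>
     (\<forall>q. \<exists>U (N::nat) X. open U \<and> q \<in> U \<and> (\<forall>a<N. X a \<in> vector_fields_on A U) \<and>
        {Z \<in> F. vsupport Z \<subseteq> U} =
        {(\<lambda>p c. \<Sum>a<N. f a p *\<^sub>R X a p c) |f. \<forall>a<N. f a \<in> compactly_supported_functions A U})"

text \<open>\<open>F\<^sub>q\<close>, the tangent space at \<open>q\<close> of the leaf through \<open>q\<close>.\<close>

definition leaf_tangent :: "('a, 'e) vfield set \<Rightarrow> 'a \<Rightarrow> ('a, 'e) tvector set" where
  "leaf_tangent F q = {X q |X. X \<in> F}"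

definition module_SRF ::
    "('a::{t2_space, second_countable_topology}, 'e::{real_inner, heine_borel}) chart set
      \<Rightarrow> ('a, 'e) bilinear_field \<Rightarrow> ('a, 'e) vfield set \<Rightarrow> bool" where
  "module_SRF A g F \<longleftrightarrow>
     riemannian_metric A g \<and> singular_foliation A F \<and>
     (\<forall>X\<in>F. \<exists>(N::nat) \<omega> Y. (\<forall>i<N. \<omega> i \<in> one_forms A \<and> Y i \<in> F) \<and>
        (\<forall>V\<in>vector_fields A. \<forall>W\<in>vector_fields A. \<forall>q.
           lie_derivative_metric A X g V W q =
           (\<Sum>i<N. sym_product (\<omega> i) (flat g (Y i)) q (V q) (W q))))"

definition geometric_SRF ::
    "('a::{t2_space, second_countable_topology}, 'e::{real_inner, heine_borel}) chart set
      \<Rightarrow> ('a, 'e) bilinear_field \<Rightarrow> ('a, 'e) vfield set \<Rightarrow> bool" where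
  "geometric_SRF A g F \<longleftrightarrow>
     riemannian_metric A g \<and> singular_foliation A F \<and>
     (\<forall>I \<gamma> t\<^sub>0. geodesic A g I \<gamma> \<and> t\<^sub>0 \<in> I \<and>
        (\<forall>w\<in>leaf_tangent F (\<gamma> t\<^sub>0). g (\<gamma> t\<^sub>0) (velocity A I \<gamma> t\<^sub>0) w = 0) \<longrightarrow>
        (\<forall>t\<in>I. \<forall>w\<in>leaf_tangent F (\<gamma> t). g (\<gamma> t) (velocity A I \<gamma> t) w = 0))"

end

theory Submission
  imports Defs "HOL-Library.Landau_Symbols"
begin

text \<open>
  Along a geodesic \<open>\<gamma>\<close>, the momentum \<open>g(\<gamma>', X)\<close> of a vector field \<open>X\<close> has derivative
  \<open>(\<L>\<^sub>X g)(\<gamma>', \<gamma>') / 2\<close>.  For \<open>X\<close> in the foliation the module condition turns this into a combination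
  of momenta of elements of the foliation.  By local finite generation these are in turn bounded
  combinations of the momenta of finitely many elements \<open>Z\<^sub>1, \<dots>, Z\<^sub>N\<close>.  So the momenta of the \<open>Z\<^sub>a\<close>
  locally satisfy a homogeneous linear differential system, and vanish on a neighbourhood as soon as
  they vanish at one time.  Connectedness of the domain of \<open>\<gamma>\<close> concludes.
\<close>

section \<open>Finite-dimensional inner product spaces\<close>

text \<open>Pointwise spanning of the leaf tangent spaces would not suffice: their dimension may
  jump, and coefficients with respect to vectors that span at each point need not stay bounded. The
  module structure supplies smooth coefficients, and so a linear system with locally bounded ones.
  The local generators live on an open set only and need not be elements of the foliation; a cutoff
  turns them into such elements. The factor 1/2 reflects (\<L>_X g)(v, v) = 2 g(\<nabla>_v X, v):
  along a geodesic the acceleration drops out and only g(\<gamma>', \<nabla>_\<gamma>' X) remains.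
  Since \<open>lie_derivative_metric\<close> takes globally defined vector fields, the velocity at a
  single time has to be extended to the whole manifold, again by a cutoff. The bracket in it must be
  known to be a tangent vector before the metric can be expressed in coordinates, which calls for
  the symmetry of second derivatives. Smoothness is formulated direction by direction, so the
  calculus with varying directions rests on expansions in a finite family
  \<open>onb\<close>.\<close>

lemma span_eq_UNIV_if_orthogonal_trivial:
  fixes C :: "'e::real_inner set"
  assumes "finite C" and triv: "\<And>x. (\<And>c. c \<in> C \<Longrightarrow> x \<bullet> c = 0) \<Longrightarrow> x = 0"
  shows "\<exists>B::'e set. finite B \<and> (\<forall>x. (\<Sum>b\<in>B. (x \<bullet> b) *\<^sub>R b) = x)" and "span C = UNIV"
proof -
  \<comment> \<open>Gram-Schmidt: what remains of a vector after projecting to \<open>D\<close> is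
    orthogonal to \<open>D\<close>, hence to \<open>C\<close>, hence zero.\<close>
  obtain D where D: "finite D" "span D = span C" "pairwise orthogonal D"
    using basis_orthogonal[OF assms(1)] by blast
  \<comment> \<open>\<open>D\<close> may contain 0; its summand vanishes because division by 0
    yields 0.\<close>
  have repr: "(\<Sum>d\<in>D. ((x \<bullet> d) / (d \<bullet> d)) *\<^sub>R d) = x" for x
  proof -
    define y where "y = x - (\<Sum>d\<in>D. ((x \<bullet> d) / (d \<bullet> d)) *\<^sub>R d)"
    have "y \<bullet> e = 0" if "e \<in> D" for e
    proof -
      have "(\<Sum>d\<in>D. ((x \<bullet> d) / (d \<bullet> d)) * (d \<bullet> e)) = (\<Sum>d\<in>D. if d = e then x \<bullet> e else 0)"
        using D(3) that by (intro sum.cong) (auto simp: pairwise_def orthogonal_def)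
      then show ?thesis
        using D(1) that by (simp add: y_def inner_diff_left inner_sum_left)
    qed
    then have "y \<bullet> e = 0" if "e \<in> span D" for e
      using orthogonal_to_span[of e D y] that by (auto simp: orthogonal_def inner_commute)
    then have "y = 0"
      using triv D(2) by (simp add: span_base)
    then show ?thesis by (simp add: y_def)
  qed
  let ?n = "\<lambda>d::'e. d /\<^sub>R norm d"
  have inj: "inj_on ?n (D - {0})"
  proof (rule inj_onI, rule ccontr)
    fix d e assume de: "d \<in> D - {0}" "e \<in> D - {0}" "?n d = ?n e" "d \<noteq> e"
    then have "d \<bullet> e = 0"
      using D(3) by (simp add: pairwise_def orthogonal_def)
    then have "?n d \<bullet> ?n e = 0" by simp
    moreover have "?n e \<bullet> ?n e \<noteq> 0" using de by auto
    ultimately show False using de(3) by metis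
  qed
  have "(\<Sum>b\<in>?n ` (D - {0}). (x \<bullet> b) *\<^sub>R b) = x" for x
  proof -
    have "(\<Sum>b\<in>?n ` (D - {0}). (x \<bullet> b) *\<^sub>R b) = (\<Sum>d\<in>D - {0}. ((x \<bullet> d) / (d \<bullet> d)) *\<^sub>R d)"
      using inj by (simp add: sum.reindex dot_square_norm power2_eq_square divide_simps)
    also have "\<dots> = (\<Sum>d\<in>D. ((x \<bullet> d) / (d \<bullet> d)) *\<^sub>R d)"
      using D(1) by (intro sum.mono_neutral_left) auto
    finally show ?thesis using repr by simp
  qed
  moreover have "finite (?n ` (D - {0}))" using D(1) by simp
  ultimately have "finite (?n ` (D - {0})) \<and>
      (\<forall>x. (\<Sum>b\<in>?n ` (D - {0}). (x \<bullet> b) *\<^sub>R b) = x)" by simp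
  then show "\<exists>B::'e set. finite B \<and> (\<forall>x. (\<Sum>b\<in>B. (x \<bullet> b) *\<^sub>R b) = x)" by (rule exI)
  have "(\<Sum>d\<in>D. ((x \<bullet> d) / (d \<bullet> d)) *\<^sub>R d) \<in> span D" for x
    by (intro span_sum span_scale) (rule span_base)
  then have "x \<in> span D" for x
    unfolding repr .
  then show "span C = UNIV" using D(2) by auto
qed

text \<open>Only the expansion of vectors is used, so orthonormality is not required of the basis.\<close>

definition onb :: "'e::{real_inner, heine_borel} set" where
  "onb = (SOME B. finite B \<and> (\<forall>x. (\<Sum>b\<in>B. (x \<bullet> b) *\<^sub>R b) = x))"

text \<open>The Heine-Borel property gives a finite 1/2-net of the unit ball. By Pythagoras, a unit
  vector orthogonal to all points of the net would have distance at least 1 from each of them, so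
  only 0 is orthogonal to the net.\<close>

lemma onb: "finite (onb :: 'e::{real_inner, heine_borel} set)"
  "(\<Sum>b\<in>onb. (x \<bullet> b) *\<^sub>R b) = (x::'e)"
proof -
  have "compact (cball (0::'e) 1)" by (simp add: compact_eq_bounded_closed)
  moreover have "cball (0::'e) 1 \<subseteq> (\<Union>c\<in>cball 0 1. ball c (1/2))" by force
  ultimately obtain C where C: "C \<subseteq> cball 0 1" "finite C" "cball (0::'e) 1 \<subseteq> (\<Union>c\<in>C. ball c (1/2))"
    using compactE_image[of "cball (0::'e) 1" "cball (0::'e) 1" "\<lambda>c. ball c (1/2)"] by auto
  have "x = 0" if x: "\<And>c. c \<in> C \<Longrightarrow> x \<bullet> c = 0" for x :: 'e
  proof (rule ccontr)
    assume "x \<noteq> 0"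
    define y where "y = x /\<^sub>R norm x"
    have y: "norm y = 1" using \<open>x \<noteq> 0\<close> by (simp add: y_def)
    then obtain c where c: "c \<in> C" "dist c y < 1/2" using C(3) by force
    have "y \<bullet> c = 0" using x[OF c(1)] by (simp add: y_def)
    then have "(dist c y)\<^sup>2 = (norm c)\<^sup>2 + (norm y)\<^sup>2"
      unfolding dist_norm power2_norm_eq_inner by (simp add: inner_diff inner_commute)
    then have "(dist c y)\<^sup>2 = (norm c)\<^sup>2 + 1" using y by simp
    then have "(dist c y)\<^sup>2 \<ge> 1" by simp
    moreover have "(dist c y)\<^sup>2 < 1" using c(2) by (simp add: power_less_one_iff)
    ultimately show False by simp
  qed
  then have "\<exists>B. finite B \<and> (\<forall>x::'e. (\<Sum>b\<in>B. (x \<bullet> b) *\<^sub>R b) = x)"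
    by (rule span_eq_UNIV_if_orthogonal_trivial[OF C(2)])
  then have "finite (onb :: 'e set) \<and> (\<forall>x::'e. (\<Sum>b\<in>onb. (x \<bullet> b) *\<^sub>R b) = x)"
    unfolding onb_def by (rule someI_ex)
  then show "finite (onb :: 'e set)" "(\<Sum>b\<in>onb. (x \<bullet> b) *\<^sub>R b) = (x::'e)" by auto
qed

lemma linear_onb:
  fixes L :: "'e::{real_inner, heine_borel} \<Rightarrow> 'v::real_vector"
  assumes "linear L"
  shows "L x = (\<Sum>b\<in>onb. (x \<bullet> b) *\<^sub>R L b)"
  by (subst onb(2)[of x, symmetric]) (simp add: linear_sum[OF assms] linear_scale[OF assms])

text \<open>\<open>L\<close> represents \<open>G\<close> through the inner product. A vector
  \<open>x\<close> orthogonal to the image of the basis satisfies \<open>G x x = 0\<close> and so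
  vanishes; hence \<open>L\<close> is onto. This makes the definite description in
  \<open>christoffel\<close> meaningful.\<close>

lemma riesz_pos_def:
  fixes G :: "'e::{real_inner, heine_borel} \<Rightarrow> 'e \<Rightarrow> real"
  assumes l: "\<And>v. linear (\<lambda>u. G u v)" and r: "\<And>u. linear (G u)"
    and pos: "\<And>u. u \<noteq> 0 \<Longrightarrow> G u u > 0" and ell: "linear k"
  shows "\<exists>!z. \<forall>v. G z v = k v"
proof -
  define L where "L z = (\<Sum>b\<in>onb. G z b *\<^sub>R b)" for z
  have inner_onb: "(\<Sum>b\<in>onb. j b *\<^sub>R b) \<bullet> v = j v" if "linear j" for j and v :: 'e
    using linear_onb[OF that, of v] by (simp add: inner_sum_left mult.commute inner_commute[of v])
  have L: "L z \<bullet> v = G z v" for z v unfolding L_def by (rule inner_onb[OF r])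
  have linL: "linear L" unfolding L_def
    by (rule linearI) (simp_all add: linear_add[OF l] linear_scale[OF l] scaleR_left_distrib
        sum.distrib scaleR_sum_right)
  have "span (L ` onb) = UNIV"
  proof (rule span_eq_UNIV_if_orthogonal_trivial(2))
    show "finite (L ` onb)" by (intro finite_imageI onb(1))
    fix x assume x: "\<And>c. c \<in> L ` onb \<Longrightarrow> x \<bullet> c = 0"
    have "x \<bullet> L x = (\<Sum>b\<in>onb. (x \<bullet> b) * (x \<bullet> L b))"
      by (subst linear_onb[OF linL]) (simp add: inner_sum_right)
    also have "\<dots> = 0" by (rule sum.neutral) (simp add: x)
    finally have "G x x = 0" by (simp add: L[symmetric] inner_commute)
    then show "x = 0" using pos[of x] by force
  qed
  moreover have "span (L ` onb) \<subseteq> range L"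
    by (intro span_minimal linear_subspace_image[OF linL] subspace_UNIV image_mono) simp
  ultimately have "range L = UNIV" by auto
  then obtain z where "L z = (\<Sum>b\<in>onb. k b *\<^sub>R b)" by (metis surjD)
  then have z: "G z v = k v" for v using L[of z v] inner_onb[OF ell] by metis
  moreover have "z' = z" if "\<forall>v. G z' v = k v" for z'
  proof (rule ccontr)
    assume "z' \<noteq> z"
    then have "G (z' - z) (z' - z) > 0" using pos by simp
    moreover have "G (z' - z) v = 0" for v using that z linear_diff[OF l] by simp
    ultimately show False by simp
  qed
  ultimately show ?thesis by blast
qed

section \<open>Derivatives of families of linear maps\<close>

lemma frechet_eqI:
  "(f has_derivative f') (at x) \<Longrightarrow> frechet_derivative f (at x) = f'"
  using frechet_derivative_at by metis

text \<open>Additivity and homogeneity hold for every parameter near \<open>x\<close>, so both sides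
  of either identity have the same derivative in the parameter, and derivatives are unique.\<close>

lemma linear_family_derivative:
  fixes h :: "'s::real_normed_vector \<Rightarrow> 'e::real_normed_vector \<Rightarrow> 'v::real_normed_vector"
  assumes S: "open S" "x \<in> S" and lin: "\<And>y. y \<in> S \<Longrightarrow> linear (h y)"
    and h: "\<And>b. ((\<lambda>y. h y b) has_derivative (\<lambda>a. h' a b)) (at x)"
  shows "linear (h' a)"
proof (rule linearI)
  fix b c r
  have "((\<lambda>y. h y b + h y c) has_derivative (\<lambda>a. h' a b + h' a c)) (at x)"
    by (intro has_derivative_add h)
  then have "((\<lambda>y. h y (b + c)) has_derivative (\<lambda>a. h' a b + h' a c)) (at x)"
    by (rule has_derivative_transform_within_open[OF _ S]) (simp add: lin linear_add)
  from has_derivative_unique[OF this h] show "h' a (b + c) = h' a b + h' a c" by metis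
  have "((\<lambda>y. r *\<^sub>R h y b) has_derivative (\<lambda>a. r *\<^sub>R h' a b)) (at x)"
    by (intro has_derivative_scaleR_right h)
  then have "((\<lambda>y. h y (r *\<^sub>R b)) has_derivative (\<lambda>a. r *\<^sub>R h' a b)) (at x)"
    by (rule has_derivative_transform_within_open[OF _ S]) (simp add: lin linear_scale)
  from has_derivative_unique[OF this h] show "h' a (r *\<^sub>R b) = r *\<^sub>R h' a b" by metis
qed

text \<open>A product rule for a linear map applied to a vector when both vary, although
  \<open>h\<close> is only differentiable for each fixed argument: expanding \<open>u y\<close> in
  the basis leaves a finite sum of ordinary products. Linearity is required only near
  \<open>x\<close> because coordinate expressions are linear only over the range of a chart, and the
  derivative is taken within \<open>T\<close> to cover end points of an interval.\<close>

lemma has_derivative_linear_family: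
  fixes h :: "'s::real_normed_vector \<Rightarrow> 'e::{real_inner, heine_borel} \<Rightarrow> 'v::real_normed_vector"
  assumes "x \<in> T" and lin: "\<forall>\<^sub>F y in at x within T. linear (h y)" "linear (h x)" "\<And>a. linear (h' a)"
    and h: "\<And>b. ((\<lambda>y. h y b) has_derivative (\<lambda>a. h' a b)) (at x within T)"
    and u: "(u has_derivative u') (at x within T)"
  shows "((\<lambda>y. h y (u y)) has_derivative (\<lambda>a. h' a (u x) + h x (u' a))) (at x within T)"
proof -
  have "((\<lambda>y. \<Sum>b\<in>onb. (u y \<bullet> b) *\<^sub>R h y b) has_derivative
      (\<lambda>a. \<Sum>b\<in>onb. (u x \<bullet> b) *\<^sub>R h' a b + (u' a \<bullet> b) *\<^sub>R h x b)) (at x within T)"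
    by (intro has_derivative_sum has_derivative_scaleR h has_derivative_inner_left u)
  also have "(\<lambda>a. \<Sum>b\<in>onb. (u x \<bullet> b) *\<^sub>R h' a b + (u' a \<bullet> b) *\<^sub>R h x b) =
      (\<lambda>a. h' a (u x) + h x (u' a))"
    by (simp add: linear_onb[OF lin(3), symmetric] linear_onb[OF lin(2), symmetric] sum.distrib)
  finally show ?thesis
  proof (rule has_derivative_transform_eventually)
    show "\<forall>\<^sub>F y in at x within T. (\<Sum>b\<in>onb. (u y \<bullet> b) *\<^sub>R h y b) = h y (u y)"
      using lin(1) by eventually_elim (simp add: linear_onb[symmetric])
    show "(\<Sum>b\<in>onb. (u x \<bullet> b) *\<^sub>R h x b) = h x (u x)"
      using lin(2) by (simp add: linear_onb[symmetric])
  qed (rule assms(1))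
qed


section \<open>Calculus of smooth maps\<close>

lemma C_k_on_subset: "C_k_on k S f \<Longrightarrow> T \<subseteq> S \<Longrightarrow> C_k_on k T f"
  by (induction k arbitrary: f) (auto intro: continuous_on_subset)

lemma C_k_on_cong:
  assumes "open S" "\<And>x. x \<in> S \<Longrightarrow> f x = g x" "C_k_on k S f"
  shows "C_k_on k S g"
  using assms(2,3)
proof (induction k arbitrary: f g)
  case 0
  then show ?case using continuous_on_cong by force
next
  case (Suc k)
  have "frechet_derivative f (at x) = frechet_derivative g (at x)" "g differentiable at x"
    if "x \<in> S" for x
  proof -
    have f: "f differentiable at x" using Suc.prems that by simp
    show "frechet_derivative f (at x) = frechet_derivative g (at x)"
      using frechet_derivative_transform_within_open[OF f assms(1) that] Suc.prems by blast
    show "g differentiable at x"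
      using f has_derivative_transform_within_open[OF _ assms(1) that] Suc.prems
      unfolding differentiable_def by metis
  qed
  then show ?case using Suc.prems Suc.IH[of "\<lambda>x. frechet_derivative f (at x) v"
        "\<lambda>x. frechet_derivative g (at x) v" for v] by simp
qed

text \<open>On an open set any pointwise derivative \<open>D\<close> agrees with
  \<open>frechet_derivative\<close>, so inductions on the order can work with explicit
  formulas.\<close>

lemma C_k_on_SucI:
  assumes "open S" "\<And>x. x \<in> S \<Longrightarrow> (f has_derivative D x) (at x)" "\<And>v. C_k_on k S (\<lambda>x. D x v)"
  shows "C_k_on (Suc k) S f"
proof -
  have "C_k_on k S (\<lambda>x. frechet_derivative f (at x) v)" for v
    by (rule C_k_on_cong[OF assms(1) _ assms(3)[of v]]) (simp add: frechet_eqI[OF assms(2)])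
  then show ?thesis using assms(2) by (auto simp: differentiable_def)
qed

lemma C_k_on_SucD:
  assumes "C_k_on (Suc k) S f" "x \<in> S"
  shows "(f has_derivative frechet_derivative f (at x)) (at x)"
  using assms frechet_derivative_works by auto

lemma C_k_on_Suc_imp: "C_k_on (Suc k) S f \<Longrightarrow> C_k_on k S f"
proof (induction k arbitrary: f)
  case 0
  then show ?case
    by (auto intro!: differentiable_imp_continuous_on differentiable_at_imp_differentiable_on)
qed auto

lemma C_k_on_Un:
  assumes "open S" "open T"
  shows "C_k_on k S f \<Longrightarrow> C_k_on k T f \<Longrightarrow> C_k_on k (S \<union> T) f"
  by (induction k arbitrary: f) (auto intro: continuous_on_open_Un assms)

lemma C_k_on_const: "C_k_on k S (\<lambda>x. c)"
  by (induction k arbitrary: c) auto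

lemma C_k_on_bounded_linear: "open S \<Longrightarrow> bounded_linear L \<Longrightarrow> C_k_on k S L"
  by (cases k) (auto simp: linear_continuous_on C_k_on_const
      intro!: C_k_on_SucI[of S L "\<lambda>_. L"] bounded_linear_imp_has_derivative simp del: C_k_on.simps(2))

lemma C_k_on_add:
  assumes "open S"
  shows "C_k_on k S f \<Longrightarrow> C_k_on k S g \<Longrightarrow> C_k_on k S (\<lambda>x. f x + g x)"
proof (induction k arbitrary: f g)
  case (Suc k)
  show ?case
    by (rule C_k_on_SucI[OF assms has_derivative_add[OF Suc.prems[THEN C_k_on_SucD]]])
      (use Suc in auto)
qed (auto intro: continuous_intros)

lemma C_k_on_sum:
  assumes "open S" "\<And>i. i \<in> I \<Longrightarrow> C_k_on k S (f i)"
  shows "C_k_on k S (\<lambda>x. \<Sum>i\<in>I. f i x)"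
  using assms(2)
  by (induction I rule: infinite_finite_induct) (auto intro: C_k_on_const C_k_on_add[OF assms(1)])

lemma (in bounded_bilinear) C_k_on:
  assumes "open S"
  shows "C_k_on k S f \<Longrightarrow> C_k_on k S g \<Longrightarrow> C_k_on k S (\<lambda>x. prod (f x) (g x))"
proof (induction k arbitrary: f g)
  case 0
  then show ?case by (simp add: continuous_on)
next
  case (Suc k)
  note fg = Suc.prems[THEN C_k_on_Suc_imp]
  show ?case
    by (rule C_k_on_SucI[OF assms FDERIV[OF Suc.prems[THEN C_k_on_SucD]]])
      (use Suc.prems fg in \<open>auto intro!: C_k_on_add[OF assms] Suc.IH\<close>)
qed

text \<open>In the chain rule the derivative of \<open>f\<close> is applied to a direction that
  moves with \<open>x\<close>, whereas \<open>C_k_on\<close> controls fixed directions only.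
  Expanding that direction in the basis gives a sum of products, and the induction hypothesis
  applies to each \<open>f\<close>-derivative along a basis vector.\<close>

lemma C_k_on_compose:
  fixes f :: "'e::{real_inner, heine_borel} \<Rightarrow> 'v::real_normed_vector"
  assumes "open S" "g ` S \<subseteq> T"
  shows "C_k_on k T f \<Longrightarrow> C_k_on k S g \<Longrightarrow> C_k_on k S (\<lambda>x. f (g x))"
proof (induction k arbitrary: f)
  case 0
  then show ?case using assms(2) by (auto intro: continuous_on_compose2)
next
  case (Suc k)
  let ?Df = "\<lambda>x. frechet_derivative f (at x)" and ?Dg = "\<lambda>x. frechet_derivative g (at x)"
  have f: "(f has_derivative ?Df (g x)) (at (g x))" if "x \<in> S" for x
    using C_k_on_SucD[OF Suc.prems(1)] that assms(2) by auto
  show ?case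
  proof (rule C_k_on_SucI[OF assms(1)])
    fix x assume x: "x \<in> S"
    have "((\<lambda>x. f (g x)) has_derivative (\<lambda>v. ?Df (g x) (?Dg x v))) (at x)"
      using has_derivative_compose[OF C_k_on_SucD[OF Suc.prems(2) x] f[OF x]] .
    also have "(\<lambda>v. ?Df (g x) (?Dg x v)) = (\<lambda>v. \<Sum>b\<in>onb. (?Dg x v \<bullet> b) *\<^sub>R ?Df (g x) b)"
      using linear_onb[OF has_derivative_linear[OF f[OF x]]] by blast
    finally show "((\<lambda>x. f (g x)) has_derivative
      (\<lambda>v. \<Sum>b\<in>onb. (?Dg x v \<bullet> b) *\<^sub>R ?Df (g x) b)) (at x)" .
  next
    fix v
    have g: "C_k_on k S g" using Suc.prems(2) by (rule C_k_on_Suc_imp)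
    show "C_k_on k S (\<lambda>x. \<Sum>b\<in>onb. (?Dg x v \<bullet> b) *\<^sub>R ?Df (g x) b)"
      using Suc.prems g
      by (intro C_k_on_sum assms(1) bounded_bilinear.C_k_on[OF bounded_bilinear_scaleR]
          bounded_bilinear.C_k_on[OF bounded_bilinear_inner] C_k_on_const Suc.IH) auto
  qed
qed

lemma smooth_onD: "smooth_on S f \<Longrightarrow> x \<in> S \<Longrightarrow> (f has_derivative frechet_derivative f (at x)) (at x)"
  unfolding smooth_on_def using C_k_on_SucD by blast

lemma smooth_on_continuous: "smooth_on S f \<Longrightarrow> continuous_on S f"
  unfolding smooth_on_def by (metis C_k_on.simps(1))

lemma smooth_on_frechet_derivative:
  "smooth_on S f \<Longrightarrow> smooth_on S (\<lambda>x. frechet_derivative f (at x) v)"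
  unfolding smooth_on_def using C_k_on.simps(2) by blast

lemma smooth_on_subset: "smooth_on S f \<Longrightarrow> T \<subseteq> S \<Longrightarrow> smooth_on T f"
  unfolding smooth_on_def using C_k_on_subset by blast

lemma smooth_on_cong:
  "open S \<Longrightarrow> (\<And>x. x \<in> S \<Longrightarrow> f x = g x) \<Longrightarrow> smooth_on S f \<Longrightarrow> smooth_on S g"
  unfolding smooth_on_def using C_k_on_cong by blast

lemma smooth_on_Un:
  "open S \<Longrightarrow> open T \<Longrightarrow> smooth_on S f \<Longrightarrow> smooth_on T f \<Longrightarrow> smooth_on (S \<union> T) f"
  unfolding smooth_on_def using C_k_on_Un by blast

lemma smooth_on_const: "smooth_on S (\<lambda>x. c)"
  by (simp add: smooth_on_def C_k_on_const)

lemma smooth_on_scaleR: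
  "open S \<Longrightarrow> smooth_on S f \<Longrightarrow> smooth_on S g \<Longrightarrow> smooth_on S (\<lambda>x. f x *\<^sub>R g x)"
  unfolding smooth_on_def using bounded_bilinear.C_k_on[OF bounded_bilinear_scaleR] by blast

lemma smooth_on_compose:
  fixes f :: "'e::{real_inner, heine_borel} \<Rightarrow> 'v::real_normed_vector"
  shows "open S \<Longrightarrow> g ` S \<subseteq> T \<Longrightarrow> smooth_on T f \<Longrightarrow> smooth_on S g \<Longrightarrow> smooth_on S (\<lambda>x. f (g x))"
  unfolding smooth_on_def using C_k_on_compose by blast


section \<open>Symmetry of second derivatives and bump functions\<close>

text \<open>Two applications of the mean value theorem, first in direction \<open>v\<close> to the
  increment of \<open>f\<close> along \<open>h *\<^sub>R w\<close>, then in direction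
  \<open>w\<close> to \<open>f'\<close>. The second-order difference on the left is symmetric in
  \<open>v\<close> and \<open>w\<close>, and \<open>clairaut_real\<close> exploits exactly
  this.\<close>

lemma mixed_difference_mvt:
  fixes f :: "'e::real_normed_vector \<Rightarrow> real"
  assumes r: "ball x r \<subseteq> S" "h > 0" "h * (norm v + norm w) < r"
    and f: "\<And>y. y \<in> S \<Longrightarrow> (f has_derivative f' y) (at y)"
    and f': "\<And>y. y \<in> S \<Longrightarrow> ((\<lambda>y. f' y v) has_derivative f'' y) (at y)"
  shows "\<exists>y \<in> ball x r. f (x + h *\<^sub>R v + h *\<^sub>R w) - f (x + h *\<^sub>R v) - f (x + h *\<^sub>R w) + f x = h * h * f'' y w"
proof -
  have in_ball: "x + s *\<^sub>R v + t *\<^sub>R w \<in> ball x r" if "0 \<le> s" "s \<le> h" "0 \<le> t" "t \<le> h" for s t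
  proof -
    have "norm (s *\<^sub>R v + t *\<^sub>R w) \<le> h * norm v + h * norm w"
      by (rule norm_triangle_le) (use that in \<open>auto intro!: add_mono mult_right_mono\<close>)
    also have "\<dots> < r" using r(3) by (simp add: distrib_left)
    finally show ?thesis
      by (simp add: dist_norm add.assoc norm_minus_cancel[of "s *\<^sub>R v + t *\<^sub>R w", symmetric]
          del: norm_minus_cancel)
  qed
  have d1: "((\<lambda>s. f (x + s *\<^sub>R v + t *\<^sub>R w)) has_real_derivative f' (x + s *\<^sub>R v + t *\<^sub>R w) v) (at s)"
    if "0 \<le> s" "s \<le> h" "0 \<le> t" "t \<le> h" for s t
  proof -
    have fy: "(f has_derivative f' (x + s *\<^sub>R v + t *\<^sub>R w)) (at (x + s *\<^sub>R v + t *\<^sub>R w))"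
      using f in_ball[OF that] r(1) by blast
    have "((\<lambda>s. x + s *\<^sub>R v + t *\<^sub>R w) has_derivative (\<lambda>a. a *\<^sub>R v)) (at s)"
      by (auto intro!: derivative_eq_intros)
    from has_derivative_compose[OF this fy]
    show ?thesis
      using linear_scale[OF has_derivative_linear[OF fy]]
      by (auto simp: has_field_derivative_def mult.commute elim!: has_derivative_eq_rhs)
  qed
  have d2: "((\<lambda>t. f' (x + s *\<^sub>R v + t *\<^sub>R w) v) has_real_derivative f'' (x + s *\<^sub>R v + t *\<^sub>R w) w) (at t)"
    if "0 \<le> s" "s \<le> h" "0 \<le> t" "t \<le> h" for s t
  proof -
    have fy: "((\<lambda>y. f' y v) has_derivative f'' (x + s *\<^sub>R v + t *\<^sub>R w)) (at (x + s *\<^sub>R v + t *\<^sub>R w))"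
      using f' in_ball[OF that] r(1) by blast
    have "((\<lambda>t. x + s *\<^sub>R v + t *\<^sub>R w) has_derivative (\<lambda>a. a *\<^sub>R w)) (at t)"
      by (auto intro!: derivative_eq_intros)
    from has_derivative_compose[OF this fy]
    show ?thesis
      using linear_scale[OF has_derivative_linear[OF fy]]
      by (auto simp: has_field_derivative_def mult.commute elim!: has_derivative_eq_rhs)
  qed
  have "\<exists>s>0. s < h \<and> (f (x + h *\<^sub>R v + h *\<^sub>R w) - f (x + h *\<^sub>R v + 0 *\<^sub>R w))
      - (f (x + 0 *\<^sub>R v + h *\<^sub>R w) - f (x + 0 *\<^sub>R v + 0 *\<^sub>R w)) =
      (h - 0) * (f' (x + s *\<^sub>R v + h *\<^sub>R w) v - f' (x + s *\<^sub>R v + 0 *\<^sub>R w) v)"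
    by (rule MVT2[OF \<open>h > 0\<close>]) (use \<open>h > 0\<close> in \<open>intro DERIV_diff d1; auto\<close>)
  then obtain s where s: "0 < s" "s < h" "f (x + h *\<^sub>R v + h *\<^sub>R w) - f (x + h *\<^sub>R v) - f (x + h *\<^sub>R w) + f x =
      h * (f' (x + s *\<^sub>R v + h *\<^sub>R w) v - f' (x + s *\<^sub>R v + 0 *\<^sub>R w) v)" by auto
  have "\<exists>t>0. t < h \<and> f' (x + s *\<^sub>R v + h *\<^sub>R w) v - f' (x + s *\<^sub>R v + 0 *\<^sub>R w) v =
      (h - 0) * f'' (x + s *\<^sub>R v + t *\<^sub>R w) w"
    by (rule MVT2[OF \<open>h > 0\<close>]) (use \<open>h > 0\<close> s in \<open>intro d2; auto\<close>)
  then obtain t where t: "0 < t" "t < h" "f' (x + s *\<^sub>R v + h *\<^sub>R w) v - f' (x + s *\<^sub>R v + 0 *\<^sub>R w) v =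
      h * f'' (x + s *\<^sub>R v + t *\<^sub>R w) w" by auto
  show ?thesis
    using s t in_ball[of s t] by (intro bexI[of _ "x + s *\<^sub>R v + t *\<^sub>R w"]) auto
qed

text \<open>One and the same second-order difference, divided by \<open>h * h\<close>, is a value of
  either mixed derivative at a point near \<open>x\<close>. By continuity each value is within
  \<open>e\<close> of the one at \<open>x\<close>, so two values \<open>2 * e\<close> apart are
  impossible.\<close>

lemma clairaut_real:
  fixes f :: "'e::real_normed_vector \<Rightarrow> real"
  assumes S: "open S" "x \<in> S"
    and f: "\<And>y. y \<in> S \<Longrightarrow> (f has_derivative f' y) (at y)"
    and f': "\<And>y u. y \<in> S \<Longrightarrow> ((\<lambda>y. f' y u) has_derivative f'' u y) (at y)"
    and cont: "\<And>u a. continuous_on S (\<lambda>y. f'' u y a)"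
  shows "f'' v x w = f'' w x v"
proof (rule ccontr)
  assume neq: "f'' v x w \<noteq> f'' w x v"
  define e where "e = \<bar>f'' v x w - f'' w x v\<bar> / 2"
  have e: "e > 0" using neq by (simp add: e_def)
  have "\<exists>r>0. ball x r \<subseteq> S \<and> (\<forall>y\<in>ball x r. \<bar>f'' u y a - f'' u x a\<bar> < e)" for u a
  proof -
    have "\<exists>d>0. \<forall>y. dist y x < d \<longrightarrow> dist (f'' u y a) (f'' u x a) < e"
      using cont[of u a] S e by (simp add: continuous_on_eq_continuous_at continuous_at_eps_delta dist_real_def dist_norm)
    then obtain d where d: "d > 0" "\<And>y. dist y x < d \<Longrightarrow> dist (f'' u y a) (f'' u x a) < e" by blast
    obtain r where "r > 0" "ball x r \<subseteq> S" using S open_contains_ball by blast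
    then show ?thesis using d
      by (intro exI[of _ "min r d"]) (auto simp: dist_commute dist_real_def)
  qed
  then obtain r1 r2 where r: "r1 > 0" "ball x r1 \<subseteq> S" "\<And>y. y \<in> ball x r1 \<Longrightarrow> \<bar>f'' v y w - f'' v x w\<bar> < e"
    "r2 > 0" "ball x r2 \<subseteq> S" "\<And>y. y \<in> ball x r2 \<Longrightarrow> \<bar>f'' w y v - f'' w x v\<bar> < e" by metis
  \<comment> \<open>Small enough for the parallelogram spanned by \<open>h *\<^sub>R v\<close> and
    \<open>h *\<^sub>R w\<close> to stay in both balls; the summand 1 keeps the denominator
    positive.\<close>
  define h where "h = min r1 r2 / (norm v + norm w + 1)"
  have pos: "norm v + norm w + 1 > 0" by (smt (verit) norm_ge_zero)
  then have h: "h > 0" using r by (simp add: h_def)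
  have "h * (norm v + norm w) < h * (norm v + norm w + 1)" using h by simp
  also have "\<dots> = min r1 r2" using pos by (simp add: h_def)
  finally have hr: "h * (norm v + norm w) < r1" "h * (norm w + norm v) < r2" by (simp_all add: add.commute)
  obtain y where y: "y \<in> ball x r1"
    "f (x + h *\<^sub>R v + h *\<^sub>R w) - f (x + h *\<^sub>R v) - f (x + h *\<^sub>R w) + f x = h * h * f'' v y w"
    using mixed_difference_mvt[OF r(2) h hr(1) f f'] by blast
  obtain z where z: "z \<in> ball x r2"
    "f (x + h *\<^sub>R w + h *\<^sub>R v) - f (x + h *\<^sub>R w) - f (x + h *\<^sub>R v) + f x = h * h * f'' w z v"
    using mixed_difference_mvt[OF r(5) h hr(2) f f'] by blast
  have "h * h * f'' v y w = h * h * f'' w z v" using y(2) z(2) by (simp add: algebra_simps)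
  then have "f'' v y w = f'' w z v" using h by simp
  with r(3)[OF y(1)] r(6)[OF z(1)] show False unfolding e_def by (smt (verit) field_sum_of_halves)
qed

lemma clairaut:
  fixes f :: "'e::real_normed_vector \<Rightarrow> 'v::real_inner"
  assumes S: "open S" "x \<in> S" and f: "smooth_on S f"
  shows "frechet_derivative (\<lambda>y. frechet_derivative f (at y) v) (at x) w =
    frechet_derivative (\<lambda>y. frechet_derivative f (at y) w) (at x) v" (is "?l = ?r")
proof -
  note D = smooth_onD[OF f] smooth_onD[OF smooth_on_frechet_derivative[OF f]]
  \<comment> \<open>Pairing with an arbitrary \<open>c\<close> reduces the claim to real-valued
    functions.\<close>
  have "?l \<bullet> c = ?r \<bullet> c" for c
  proof (rule clairaut_real[OF S, where f = "\<lambda>y. f y \<bullet> c"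
          and f'' = "\<lambda>v y w. frechet_derivative (\<lambda>y. frechet_derivative f (at y) v) (at y) w \<bullet> c"])
    show "((\<lambda>y. f y \<bullet> c) has_derivative (\<lambda>u. frechet_derivative f (at y) u \<bullet> c)) (at y)"
      if "y \<in> S" for y
      using that by (intro has_derivative_inner_left D)
    show "((\<lambda>y. frechet_derivative f (at y) u \<bullet> c) has_derivative
        (\<lambda>w. frechet_derivative (\<lambda>y. frechet_derivative f (at y) u) (at y) w \<bullet> c)) (at y)"
      if "y \<in> S" for y u
      using that by (intro has_derivative_inner_left D)
    show "continuous_on S
        (\<lambda>y. frechet_derivative (\<lambda>y. frechet_derivative f (at y) u) (at y) a \<bullet> c)" for u a
      by (intro continuous_on_inner continuous_on_const smooth_on_continuous
          smooth_on_frechet_derivative f)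
  qed
  then show ?thesis by (metis inner_commute vector_eq_rdot)
qed

text \<open>For \<open>n = 0\<close> the classical function exp(-1/t), extended by 0. The powers of
  1/t make the family closed under differentiation up to linear combinations, so that one induction
  proves all members smooth.\<close>

definition flat_exp :: "nat \<Rightarrow> real \<Rightarrow> real" where
  "flat_exp n t = (if t > 0 then inverse t ^ n / exp (inverse t) else 0)"

lemma flat_exp_tendsto_0: "(flat_exp n \<longlongrightarrow> 0) (at 0)"
  unfolding filterlim_at_split
proof
  show "(flat_exp n \<longlongrightarrow> 0) (at_left 0)"
    by (rule tendsto_eventually) (auto simp: eventually_at_filter flat_exp_def)
  have "((\<lambda>t::real. inverse t ^ n / exp (inverse t)) \<longlongrightarrow> 0) (at_right 0)"
    by (rule filterlim_compose[OF tendsto_power_div_exp_0 filterlim_inverse_at_top_right])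
  then show "(flat_exp n \<longlongrightarrow> 0) (at_right 0)"
    by (rule Lim_transform_eventually) (auto simp: eventually_at_filter flat_exp_def)
qed

lemma flat_exp_deriv:
  "(flat_exp n has_real_derivative flat_exp (n + 2) t - n * flat_exp (n + 1) t) (at t)"
proof -
  consider "t < 0" | "t = 0" | "t > 0" by linarith
  then show ?thesis
  proof cases
    case 1
    have "((\<lambda>t. 0) has_real_derivative 0) (at t)" by simp
    then have "(flat_exp n has_real_derivative 0) (at t)"
      by (rule has_field_derivative_transform_within_open[of _ _ _ "{..<0}"])
        (use 1 in \<open>auto simp: flat_exp_def\<close>)
    then show ?thesis using 1 by (simp add: flat_exp_def)
  next
    case 2
    \<comment> \<open>For \<open>h\<close> of either sign the difference quotient at 0 is
      \<open>flat_exp (n + 1) h\<close>.\<close>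
    have "((\<lambda>h. (flat_exp n (0 + h) - flat_exp n 0) / h) \<longlongrightarrow> 0) (at 0)"
      by (rule Lim_transform_eventually[OF flat_exp_tendsto_0[of "n + 1"]])
        (auto simp: eventually_at_filter flat_exp_def field_simps)
    then have "(flat_exp n has_real_derivative 0) (at 0)" unfolding DERIV_def .
    then show ?thesis using 2 by (simp add: flat_exp_def)
  next
    case 3
    have "m = 0 \<or> t * t ^ (m - Suc 0) = t ^ m" for m by (cases m) auto
    then have "((\<lambda>t. inverse t ^ n / exp (inverse t)) has_real_derivative
        flat_exp (n + 2) t - n * flat_exp (n + 1) t) (at t)"
      using 3 by (cases n)
        (auto intro!: derivative_eq_intros simp: flat_exp_def field_simps)
    then show ?thesis
      by (rule has_field_derivative_transform_within_open[of _ _ _ "{0<..}"])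
        (use 3 in \<open>auto simp: flat_exp_def\<close>)
  qed
qed

lemma smooth_flat_exp: "smooth_on UNIV (flat_exp n)"
proof -
  have "C_k_on k UNIV (flat_exp n)" for k
  proof (induction k arbitrary: n)
    case 0
    then show ?case
      using DERIV_isCont[OF flat_exp_deriv] by (simp add: continuous_on_eq_continuous_at)
  next
    case (Suc k)
    show ?case
    proof (rule C_k_on_SucI)
      show "(flat_exp n has_derivative
          (\<lambda>v. (flat_exp (n + 2) t + (- real n) * flat_exp (n + 1) t) * v)) (at t)" for t
        using flat_exp_deriv[of n t] by (simp add: has_field_derivative_def)
      show "C_k_on k UNIV (\<lambda>t. (flat_exp (n + 2) t + (- real n) * flat_exp (n + 1) t) * v)" for v
        by (intro bounded_bilinear.C_k_on[OF bounded_bilinear_mult] C_k_on_add C_k_on_const Suc) auto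
    qed auto
  qed
  then show ?thesis by (simp add: smooth_on_def)
qed

text \<open>No plateau is needed: at the center the value is 1 and the derivative vanishes.\<close>

definition bump :: "'e::real_inner \<Rightarrow> real \<Rightarrow> 'e \<Rightarrow> real" where
  "bump x\<^sub>0 R x = flat_exp 0 (R\<^sup>2 - (x - x\<^sub>0) \<bullet> (x - x\<^sub>0)) / flat_exp 0 (R\<^sup>2)"

lemma smooth_bump: "smooth_on UNIV (bump x\<^sub>0 R)"
proof -
  have "C_k_on k UNIV (\<lambda>x. R\<^sup>2 + (- 1) * ((x - x\<^sub>0) \<bullet> (x - x\<^sub>0)))" for k
    using C_k_on_bounded_linear[OF open_UNIV bounded_linear_ident]
    by (intro C_k_on_add open_UNIV C_k_on_const bounded_bilinear.C_k_on[OF bounded_bilinear_mult]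
        bounded_bilinear.C_k_on[OF bounded_bilinear_inner])
      (auto simp: diff_conv_add_uminus simp del: add_uminus_conv_diff intro!: C_k_on_add C_k_on_const)
  then have "smooth_on UNIV (\<lambda>x. R\<^sup>2 - (x - x\<^sub>0) \<bullet> (x - x\<^sub>0))"
    by (simp add: smooth_on_def)
  from smooth_on_compose[OF open_UNIV _ smooth_flat_exp[of 0] this]
  have "smooth_on UNIV (\<lambda>x. flat_exp 0 (R\<^sup>2 - (x - x\<^sub>0) \<bullet> (x - x\<^sub>0)))" by simp
  then have "smooth_on UNIV (\<lambda>x. inverse (flat_exp 0 (R\<^sup>2)) *\<^sub>R flat_exp 0 (R\<^sup>2 - (x - x\<^sub>0) \<bullet> (x - x\<^sub>0)))"
    by (intro smooth_on_scaleR smooth_on_const) auto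
  then show ?thesis by (simp add: bump_def[abs_def] field_simps)
qed

lemma bump_center: "R > 0 \<Longrightarrow> bump x R x = 1"
  by (simp add: bump_def flat_exp_def)

lemma bump_eq_0_iff:
  assumes "R > 0"
  shows "bump x\<^sub>0 R x = 0 \<longleftrightarrow> R \<le> dist x\<^sub>0 x"
proof -
  have "(norm (x - x\<^sub>0))\<^sup>2 < R\<^sup>2 \<longleftrightarrow> norm (x - x\<^sub>0) < R"
    using assms by (auto intro: power2_less_imp_less power_strict_mono)
  then show ?thesis
    using assms
    by (auto simp: bump_def flat_exp_def dist_norm norm_minus_commute[of x\<^sub>0] power2_norm_eq_inner)
qed

lemma bump_deriv_center: "(bump x R has_derivative (\<lambda>v. 0)) (at x)"
proof -
  have *: "((\<lambda>y. R\<^sup>2 - (y - x) \<bullet> (y - x)) has_derivative (\<lambda>v. 0)) (at x)"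
    by (auto intro!: derivative_eq_intros)
  have "((\<lambda>y. flat_exp 0 (R\<^sup>2 - (y - x) \<bullet> (y - x))) has_derivative (\<lambda>v. 0)) (at x)"
    using has_derivative_compose[OF * flat_exp_deriv[of 0, unfolded has_field_derivative_def]] by simp
  from has_derivative_divide'[OF this has_derivative_const]
  \<comment> \<open>For \<open>R = 0\<close> the denominator is 0, and the quotient is constantly
    0.\<close>
  show ?thesis
    by (cases "flat_exp 0 (R\<^sup>2) = 0") (auto simp: bump_def[abs_def] elim!: has_derivative_eq_rhs)
qed


section \<open>Tangent vectors and vector fields in charts\<close>

locale smooth_manifold =
  fixes A :: "('a::{t2_space, second_countable_topology}, 'e::{real_inner, heine_borel}) chart set"
  assumes atlas: "smooth_atlas A"
begin

abbreviation transition_deriv :: "('a, 'e) chart \<Rightarrow> ('a, 'e) chart \<Rightarrow> 'e \<Rightarrow> 'e \<Rightarrow> 'e" where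
  "transition_deriv c d x \<equiv> frechet_derivative (cmap d \<circ> cinv c) (at x)"

section \<open>Charts and transition maps\<close>

lemma ex_chart: "\<exists>c\<in>A. q \<in> cdom c"
  using atlas unfolding smooth_atlas_def by auto

lemma chart_at: "chart_at A q \<in> A" "q \<in> cdom (chart_at A q)"
  using someI_ex[of "\<lambda>c. c \<in> A \<and> q \<in> cdom c"] ex_chart[of q] unfolding chart_at_def by blast+

lemma open_cdom: "c \<in> A \<Longrightarrow> open (cdom c)"
  and open_cran: "c \<in> A \<Longrightarrow> open (cran c)"
  and homeo: "c \<in> A \<Longrightarrow> homeomorphism (cdom c) (cran c) (cmap c) (cinv c)"
  using atlas unfolding smooth_atlas_def by auto

lemma cinv_cmap: "c \<in> A \<Longrightarrow> q \<in> cdom c \<Longrightarrow> cinv c (cmap c q) = q"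
  using homeo homeomorphism_apply1 by metis

lemma cinv_in: "c \<in> A \<Longrightarrow> x \<in> cran c \<Longrightarrow> cinv c x \<in> cdom c"
  by (auto simp: cinv_cmap)

lemma continuous_cmap: "c \<in> A \<Longrightarrow> continuous_on (cdom c) (cmap c)"
  and continuous_cinv: "c \<in> A \<Longrightarrow> continuous_on (cran c) (cinv c)"
  using homeo homeomorphism_def by metis+

lemma cmap_image_Int:
  assumes "c \<in> A"
  shows "cmap c ` (cdom c \<inter> U) = cran c \<inter> cinv c -` U"
  by (auto simp: cinv_cmap assms)

lemma open_cmap_image: "c \<in> A \<Longrightarrow> open U \<Longrightarrow> open (cmap c ` (cdom c \<inter> U))"
  using continuous_open_preimage[OF continuous_cinv open_cran] by (simp add: cmap_image_Int)

lemma smooth_transition: "c \<in> A \<Longrightarrow> d \<in> A \<Longrightarrow> smooth_on (cmap c ` (cdom c \<inter> cdom d)) (cmap d \<circ> cinv c)"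
  using atlas unfolding smooth_atlas_def by auto

lemma transition_has_deriv:
  assumes "c \<in> A" "d \<in> A" "q \<in> cdom c" "q \<in> cdom d"
  shows "((cmap d \<circ> cinv c) has_derivative transition_deriv c d (cmap c q)) (at (cmap c q))"
  using smooth_onD[OF smooth_transition] assms by blast

lemma transition_deriv_self:
  assumes "c \<in> A" "q \<in> cdom c"
  shows "transition_deriv c c (cmap c q) u = u"
proof -
  have "((cmap c \<circ> cinv c) has_derivative (\<lambda>u. u)) (at (cmap c q))"
    by (rule has_derivative_transform_within_open[OF has_derivative_ident open_cran])
      (use assms in \<open>auto simp: cinv_cmap\<close>)
  then show ?thesis by (simp add: frechet_eqI)
qed

text \<open>The chain rule, since the composite of the two transition maps agrees with the direct
  one near \<open>cmap c q\<close>. It is the compatibility that makes \<open>tvec\<close> a tangent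
  vector.\<close>

lemma transition_deriv_cocycle:
  assumes A: "c \<in> A" "d \<in> A" "e \<in> A" and q: "q \<in> cdom c" "q \<in> cdom d" "q \<in> cdom e"
  shows "transition_deriv d e (cmap d q) (transition_deriv c d (cmap c q) u) = transition_deriv c e (cmap c q) u"
proof -
  have e: "((cmap e \<circ> cinv d) has_derivative transition_deriv d e (cmap d q)) (at ((cmap d \<circ> cinv c) (cmap c q)))"
    using transition_has_deriv[of d e q] assms by (simp add: cinv_cmap)
  have "((\<lambda>x. (cmap e \<circ> cinv d) ((cmap d \<circ> cinv c) x)) has_derivative
      (\<lambda>u. transition_deriv d e (cmap d q) (transition_deriv c d (cmap c q) u))) (at (cmap c q))"
    using has_derivative_compose[OF transition_has_deriv e] assms by blast
  then have "((cmap e \<circ> cinv c) has_derivative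
      (\<lambda>u. transition_deriv d e (cmap d q) (transition_deriv c d (cmap c q) u))) (at (cmap c q))"
    by (rule has_derivative_transform_within_open[OF _ open_cmap_image[OF A(1) open_cdom[OF A(2)]]])
      (use assms in \<open>auto simp: cinv_cmap\<close>)
  from frechet_eqI[OF this] show ?thesis by simp
qed

section \<open>Tangent vectors and their components\<close>

lemma tvec_self: "c \<in> A \<Longrightarrow> q \<in> cdom c \<Longrightarrow> tvec A c q u c = u"
  by (simp add: tvec_def transition_deriv_self)

lemma tvec_in_tangent_space:
  assumes "c \<in> A" "q \<in> cdom c"
  shows "tvec A c q u \<in> tangent_space A q"
  by (simp add: tangent_space_def tvec_def transition_deriv_cocycle assms)

lemma tangent_space_component:
  assumes "v \<in> tangent_space A q" "c \<in> A" "q \<in> cdom c" "d \<in> A" "q \<in> cdom d"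
  shows "v d = transition_deriv c d (cmap c q) (v c)"
  using assms unfolding tangent_space_def by blast

lemma tvec_components:
  assumes "c \<in> A" "q \<in> cdom c" "v \<in> tangent_space A q"
  shows "tvec A c q (v c) = v"
proof
  fix d
  have "v d = transition_deriv c d (cmap c q) (v c)" if "d \<in> A" "q \<in> cdom d"
    using tangent_space_component[OF assms(3,1,2) that] .
  moreover have "v d = 0" if "\<not> (d \<in> A \<and> q \<in> cdom d)"
    using assms that unfolding tangent_space_def by blast
  ultimately show "tvec A c q (v c) d = v d" by (auto simp: tvec_def)
qed

lemma tvec_combination:
  assumes "c \<in> A" "q \<in> cdom c"
  shows "tvec A c q (a *\<^sub>R u + b *\<^sub>R w) = (\<lambda>d. a *\<^sub>R tvec A c q u d + b *\<^sub>R tvec A c q w d)"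
proof
  fix d
  have "linear (transition_deriv c d (cmap c q))" if "d \<in> A" "q \<in> cdom d"
    using has_derivative_linear[OF transition_has_deriv] assms that by blast
  then show "tvec A c q (a *\<^sub>R u + b *\<^sub>R w) d = a *\<^sub>R tvec A c q u d + b *\<^sub>R tvec A c q w d"
    by (auto simp: tvec_def linear_add linear_scale)
qed

lemma tangent_space_combination:
  assumes "v \<in> tangent_space A q" "w \<in> tangent_space A q"
  shows "(\<lambda>d. a *\<^sub>R v d + b *\<^sub>R w d) \<in> tangent_space A q"
proof -
  obtain c where c: "c \<in> A" "q \<in> cdom c" using ex_chart by blast
  have "(\<lambda>d. a *\<^sub>R v d + b *\<^sub>R w d) = tvec A c q (a *\<^sub>R v c + b *\<^sub>R w c)"
    by (simp add: tvec_combination[OF c] tvec_components[OF c] assms)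
  then show ?thesis using tvec_in_tangent_space[OF c] by metis
qed

lemma tangent_space_zero: "(\<lambda>d. 0) \<in> tangent_space A q"
proof -
  obtain c where c: "c \<in> A" "q \<in> cdom c" using ex_chart by blast
  show ?thesis
    using tangent_space_combination[of _ q _ 0 0] tvec_in_tangent_space[OF c, of 0] by force
qed

lemma tangent_space_scale: "v \<in> tangent_space A q \<Longrightarrow> (\<lambda>d. a *\<^sub>R v d) \<in> tangent_space A q"
  using tangent_space_combination[of v q v a 0] by simp

lemma vector_field_tangent: "X \<in> vector_fields A \<Longrightarrow> X q \<in> tangent_space A q"
  by (simp add: vector_fields_on_def)

lemma vector_field_smooth: "X \<in> vector_fields A \<Longrightarrow> c \<in> A \<Longrightarrow> smooth_on (cran c) (\<lambda>x. X (cinv c x) c)"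
  by (simp add: vector_fields_on_def)

lemma vector_field_has_deriv:
  assumes "X \<in> vector_fields A" "c \<in> A" "q \<in> cdom c"
  shows "((\<lambda>x. X (cinv c x) c) has_derivative
    frechet_derivative (\<lambda>x. X (cinv c x) c) (at (cmap c q))) (at (cmap c q))"
  using smooth_onD[OF vector_field_smooth] assms by blast

text \<open>The terms with second derivatives of the transition map cancel by their symmetry.\<close>

lemma lie_bracket_in_tangent_space:
  assumes X: "X \<in> vector_fields A" and Y: "Y \<in> vector_fields A"
  shows "lie_bracket A X Y q \<in> tangent_space A q"
proof -
  have "lie_bracket A X Y q d = transition_deriv c d (cmap c q) (lie_bracket A X Y q c)"
    if c: "c \<in> A" "q \<in> cdom c" and d: "d \<in> A" "q \<in> cdom d" for c d
  proof -
    let ?S = "cmap c ` (cdom c \<inter> cdom d)" and ?\<tau> = "cmap d \<circ> cinv c" and ?x = "cmap c q"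
    let ?D = "\<lambda>X e. frechet_derivative (\<lambda>x. X (cinv e x) e) (at (cmap e q))"
    let ?T = "\<lambda>y. transition_deriv c d y"
    let ?TT = "\<lambda>a b. frechet_derivative (\<lambda>y. ?T y b) (at ?x) a"
    have S: "open ?S" "?x \<in> ?S" using open_cmap_image[OF c(1) open_cdom[OF d(1)]] c d by auto
    have T: "(?\<tau> has_derivative ?T y) (at y)" if "y \<in> ?S" for y
      using smooth_onD[OF smooth_transition[OF c(1) d(1)] that] .
    have TT: "((\<lambda>y. ?T y b) has_derivative (\<lambda>a. ?TT a b)) (at ?x)" for b
      using smooth_onD[OF smooth_on_frechet_derivative[OF smooth_transition[OF c(1) d(1)]] S(2)] .
    \<comment> \<open>The component of \<open>Z\<close> in \<open>d\<close>, pulled back to the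
      chart \<open>c\<close>, is \<open>?T y\<close> applied to the component in \<open>c\<close>.
      Differentiating this identity by the chain rule on one side and the product rule on the other
      produces the extra term \<open>?TT a (Z q c)\<close>.\<close>
    have rule: "?D Z d (?T ?x a) = ?TT a (Z q c) + ?T ?x (?D Z c a)" if Z: "Z \<in> vector_fields A" for Z a
    proof -
      have Zd: "((\<lambda>x. Z (cinv d x) d) has_derivative ?D Z d) (at (?\<tau> ?x))"
        using vector_field_has_deriv[OF Z d] c by (simp add: cinv_cmap)
      have "((\<lambda>y. Z (cinv d (?\<tau> y)) d) has_derivative (\<lambda>a. ?D Z d (?T ?x a))) (at ?x)"
        by (rule has_derivative_compose[OF T[OF S(2)] Zd])
      then have 1: "((\<lambda>y. ?T y (Z (cinv c y) c)) has_derivative (\<lambda>a. ?D Z d (?T ?x a))) (at ?x)"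
      proof (rule has_derivative_transform_within_open[OF _ S])
        fix y assume "y \<in> ?S"
        then obtain p where p: "y = cmap c p" "p \<in> cdom c" "p \<in> cdom d" by auto
        show "Z (cinv d (?\<tau> y)) d = ?T y (Z (cinv c y) c)"
          using tangent_space_component[OF vector_field_tangent[OF Z] c(1) p(2) d(1) p(3)] p c d
          by (simp add: cinv_cmap)
      qed
      have "((\<lambda>y. ?T y (Z (cinv c y) c)) has_derivative
          (\<lambda>a. ?TT a (Z (cinv c ?x) c) + ?T ?x (?D Z c a))) (at ?x)"
        using linear_family_derivative[OF S has_derivative_linear[OF T] TT]
        by (intro has_derivative_linear_family UNIV_I TT vector_field_has_deriv[OF Z c]
            has_derivative_linear[OF T] S eventually_mono[OF eventually_at_in_open'[OF S]])
      from fun_cong[OF has_derivative_unique[OF 1 this], of a] show ?thesis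
        unfolding cinv_cmap[OF c] .
    qed
    have sym: "?TT a b = ?TT b a" for a b
      by (rule clairaut[OF S smooth_transition[OF c(1) d(1)]])
    have Zd: "Z q d = ?T ?x (Z q c)" if "Z \<in> vector_fields A" for Z
      by (rule tangent_space_component[OF vector_field_tangent[OF that] c d])
    show ?thesis
      using c d sym[of "Y q c" "X q c"] rule[OF X, of "Y q c"] rule[OF Y, of "X q c"]
      by (simp add: lie_bracket_def Zd[OF X] Zd[OF Y] linear_diff[OF has_derivative_linear[OF T[OF S(2)]]])
  qed
  moreover have "lie_bracket A X Y q c = 0" if "\<not> (c \<in> A \<and> q \<in> cdom c)" for c
    using that by (auto simp: lie_bracket_def)
  ultimately show ?thesis unfolding tangent_space_def by blast
qed

section \<open>Extension by zero, cutoff functions and global vector fields\<close>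

lemma smooth_on_chart_extension:
  fixes f :: "'a \<Rightarrow> 'v::real_normed_vector"
  assumes "d \<in> A" "open W" "closed K" "K \<subseteq> W" "\<And>q. q \<notin> K \<Longrightarrow> f q = 0"
    and smooth: "smooth_on (cmap d ` (cdom d \<inter> W)) (\<lambda>x. f (cinv d x))"
  shows "smooth_on (cran d) (\<lambda>x. f (cinv d x))"
proof -
  \<comment> \<open>The chart is covered by the two open sets \<open>W\<close>, where smoothness is
    assumed, and the complement of \<open>K\<close>, where \<open>f\<close> vanishes.\<close>
  have op: "open (cmap d ` (cdom d \<inter> W))" "open (cmap d ` (cdom d \<inter> - K))"
    by (intro open_cmap_image assms open_Compl)+
  have "smooth_on (cmap d ` (cdom d \<inter> - K)) (\<lambda>x. f (cinv d x))"
    by (rule smooth_on_cong[OF op(2) _ smooth_on_const[of _ 0]])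
      (use assms in \<open>auto simp: cinv_cmap\<close>)
  from smooth_on_Un[OF op smooth this]
  have "smooth_on (cmap d ` (cdom d \<inter> W) \<union> cmap d ` (cdom d \<inter> - K)) (\<lambda>x. f (cinv d x))" .
  moreover have "cmap d ` (cdom d \<inter> W) \<union> cmap d ` (cdom d \<inter> - K) = cran d"
    using assms(4) by blast
  ultimately show ?thesis by simp
qed

lemma smooth_function_continuous:
  assumes "f \<in> smooth_functions A"
  shows "continuous_on UNIV f"
proof -
  have "continuous (at q) f" for q
  proof -
    obtain c where c: "c \<in> A" "q \<in> cdom c" using ex_chart by blast
    have "continuous_on (cran c) (\<lambda>x. f (cinv c x))"
      using assms c by (auto simp: smooth_functions_def intro: smooth_on_continuous)
    from continuous_on_compose2[OF this continuous_cmap[OF c(1)]]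
    have "continuous_on (cdom c) (\<lambda>q. f (cinv c (cmap c q)))" by auto
    then have "continuous_on (cdom c) f"
      by (rule continuous_on_eq) (simp add: cinv_cmap c)
    then show ?thesis using open_cdom c continuous_on_eq_continuous_at by blast
  qed
  then show ?thesis by (simp add: continuous_at_imp_continuous_on)
qed

text \<open>The preimage \<open>K\<close> of a small closed coordinate ball is compact, hence closed
  because the manifold is Hausdorff, so a coordinate bump extends smoothly by 0. The vanishing
  derivative at \<open>q\<close> serves \<open>ex_vector_field\<close>, the control of the support
  serves \<open>foliation_local_generators\<close>.\<close>

lemma ex_bump:
  assumes c: "c \<in> A" "q \<in> cdom c" and U: "open U" "q \<in> U"
  obtains \<rho> where "\<rho> \<in> compactly_supported_functions A (cdom c \<inter> U)" "\<rho> q = 1"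
    "((\<lambda>x. \<rho> (cinv c x)) has_derivative (\<lambda>v. 0)) (at (cmap c q))"
proof -
  obtain R where R: "R > 0" "cball (cmap c q) R \<subseteq> cmap c ` (cdom c \<inter> U)"
    using open_cmap_image[OF c(1) U(1)] c U open_contains_cball by (metis IntI imageI)
  define K where "K = cinv c ` cball (cmap c q) R"
  define \<rho> where "\<rho> p = (if p \<in> cdom c then bump (cmap c q) R (cmap c p) else 0)" for p
  have ran: "cball (cmap c q) R \<subseteq> cran c" using R(2) by auto
  have "compact K" unfolding K_def
    using continuous_on_subset[OF continuous_cinv[OF c(1)] ran]
    by (intro compact_continuous_image compact_cball)
  then have clK: "closed K" by (rule compact_imp_closed)
  have KU: "K \<subseteq> cdom c \<inter> U"
  proof
    fix p assume "p \<in> K"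
    then obtain x where x: "x \<in> cball (cmap c q) R" "p = cinv c x" by (auto simp: K_def)
    then obtain p' where "p' \<in> cdom c \<inter> U" "x = cmap c p'" using R(2) by blast
    then show "p \<in> cdom c \<inter> U" using x by (simp add: cinv_cmap c)
  qed
  have K0: "\<rho> p = 0" if "p \<notin> K" for p
  proof (cases "p \<in> cdom c")
    case True
    then have "cmap c p \<notin> cball (cmap c q) R"
      using that cinv_cmap[OF c(1) True] unfolding K_def by (metis imageI)
    then show ?thesis using R by (simp add: \<rho>_def bump_eq_0_iff)
  qed (simp add: \<rho>_def)
  have "smooth_on (cran d) (\<lambda>x. \<rho> (cinv d x))" if d: "d \<in> A" for d
  proof (rule smooth_on_chart_extension[OF d open_cdom[OF c(1)] clK _ K0])
    have op: "open (cmap d ` (cdom d \<inter> cdom c))"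
      by (rule open_cmap_image[OF d open_cdom[OF c(1)]])
    show "smooth_on (cmap d ` (cdom d \<inter> cdom c)) (\<lambda>x. \<rho> (cinv d x))"
      by (rule smooth_on_cong[OF op _ smooth_on_compose[OF op _ smooth_bump smooth_transition[OF d c(1)]]])
        (auto simp: \<rho>_def cinv_cmap d)
  qed (use KU in auto)
  moreover have cl: "closure {p. \<rho> p \<noteq> 0} \<subseteq> K"
    by (rule closure_minimal[OF _ clK]) (use K0 in auto)
  moreover have "compact (closure {p. \<rho> p \<noteq> 0})"
    using compact_Int_closed[OF \<open>compact K\<close> closed_closure[of "{p. \<rho> p \<noteq> 0}"]] cl
    by (simp add: Int_absorb1)
  ultimately have 1: "\<rho> \<in> compactly_supported_functions A (cdom c \<inter> U)"
    using KU by (auto simp: compactly_supported_functions_def smooth_functions_def)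
  have 2: "\<rho> q = 1" using R c by (simp add: \<rho>_def bump_center)
  have "((\<lambda>x. \<rho> (cinv c x)) has_derivative (\<lambda>v. 0)) (at (cmap c q))"
    by (rule has_derivative_transform_within_open[OF bump_deriv_center open_cran[OF c(1)]])
      (use c in \<open>auto simp: \<rho>_def cinv_cmap\<close>)
  with 1 2 show thesis by (rule that)
qed

text \<open>Take the field with constant components \<open>v c\<close> in the chart \<open>c\<close>
  and multiply it by a cutoff. At \<open>q\<close> its derivative is that of the cutoff times
  \<open>v c\<close>, which is 0.\<close>

lemma ex_vector_field:
  assumes c: "c \<in> A" "q \<in> cdom c" and v: "v \<in> tangent_space A q"
  obtains V where "V \<in> vector_fields A" "V q = v"
    "((\<lambda>x. V (cinv c x) c) has_derivative (\<lambda>a. 0)) (at (cmap c q))"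
proof -
  obtain \<rho> where \<rho>: "\<rho> \<in> compactly_supported_functions A (cdom c \<inter> UNIV)" "\<rho> q = 1"
    "((\<lambda>x. \<rho> (cinv c x)) has_derivative (\<lambda>v. 0)) (at (cmap c q))"
    using ex_bump[OF c open_UNIV UNIV_I] .
  let ?K = "closure {p. \<rho> p \<noteq> 0}"
  have K: "?K \<subseteq> cdom c" and s: "\<rho> \<in> smooth_functions A"
    using \<rho>(1) by (auto simp: compactly_supported_functions_def)
  have K0: "\<rho> p = 0" if "p \<notin> ?K" for p
    using that closure_subset[of "{p. \<rho> p \<noteq> 0}"] by blast
  define V where "V p = (\<lambda>d. \<rho> p *\<^sub>R tvec A c p (v c) d)" for p
  have "V p \<in> tangent_space A p" for p
  proof (cases "p \<in> cdom c")
    case True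
    then show ?thesis unfolding V_def by (intro tangent_space_scale tvec_in_tangent_space c)
  next
    case False
    then have "\<rho> p = 0" using K K0 by blast
    then show ?thesis using tangent_space_zero by (simp add: V_def)
  qed
  moreover have "smooth_on (cran d) (\<lambda>x. V (cinv d x) d)" if d: "d \<in> A" for d
  proof (rule smooth_on_chart_extension[OF d open_cdom[OF c(1)] closed_closure K, of "\<lambda>p. V p d"])
    show "V p d = 0" if "p \<notin> ?K" for p using K0[OF that] by (simp add: V_def)
    let ?S = "cmap d ` (cdom d \<inter> cdom c)"
    have op: "open ?S" by (rule open_cmap_image[OF d open_cdom[OF c(1)]])
    \<comment> \<open>In the chart \<open>d\<close> the components of the constant field are the
      derivative of the transition from \<open>c\<close> to \<open>d\<close>, taken at the point
      that the transition from \<open>d\<close> to \<open>c\<close> assigns to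
      \<open>x\<close>.\<close>
    have "smooth_on ?S (\<lambda>x. transition_deriv c d ((cmap c \<circ> cinv d) x) (v c))"
      by (rule smooth_on_compose[OF op _ smooth_on_frechet_derivative[OF smooth_transition[OF c(1) d]]
            smooth_transition[OF d c(1)]])
        (auto simp: cinv_cmap d)
    moreover have "smooth_on ?S (\<lambda>x. \<rho> (cinv d x))"
      using s d by (auto simp: smooth_functions_def intro: smooth_on_subset)
    ultimately have "smooth_on ?S (\<lambda>x. \<rho> (cinv d x) *\<^sub>R transition_deriv c d ((cmap c \<circ> cinv d) x) (v c))"
      by (intro smooth_on_scaleR op)
    then show "smooth_on ?S (\<lambda>x. V (cinv d x) d)"
      by (rule smooth_on_cong[OF op, rotated]) (auto simp: V_def tvec_def cinv_cmap d)
  qed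
  ultimately have 1: "V \<in> vector_fields A" by (auto simp: vector_fields_on_def)
  have 2: "V q = v" using tvec_components[OF c v] \<rho>(2) by (simp add: V_def)
  have "((\<lambda>x. \<rho> (cinv c x) *\<^sub>R v c) has_derivative (\<lambda>a. 0)) (at (cmap c q))"
    using has_derivative_scaleR_left[OF \<rho>(3)] by simp
  then have "((\<lambda>x. V (cinv c x) c) has_derivative (\<lambda>a. 0)) (at (cmap c q))"
    by (rule has_derivative_transform_within_open[OF _ open_cran[OF c(1)]])
      (use c in \<open>auto simp: V_def tvec_self cinv_cmap\<close>)
  with 1 2 show thesis by (rule that)
qed

end


section \<open>Linear differential inequalities\<close>

text \<open>Gronwall's argument: the sum of squares, multiplied by a decreasing or an increasing exponential, is monotone.\<close>

lemma linear_ode_unique_zero: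
  fixes \<phi> :: "'i \<Rightarrow> real \<Rightarrow> real"
  assumes J: "is_interval J" and t: "t\<^sub>1 \<in> J" "t \<in> J" and fin: "finite B"
    and deriv: "\<And>a s. a \<in> B \<Longrightarrow> s \<in> J \<Longrightarrow> (\<phi> a has_real_derivative D a s) (at s within J)"
    and bound: "\<And>a s. a \<in> B \<Longrightarrow> s \<in> J \<Longrightarrow> \<bar>D a s\<bar> \<le> K * (\<Sum>b\<in>B. \<bar>\<phi> b s\<bar>)"
    and zero: "\<And>a. a \<in> B \<Longrightarrow> \<phi> a t\<^sub>1 = 0" and a: "a \<in> B"
  shows "\<phi> a t = 0"
proof -
  define \<psi> where "\<psi> s = (\<Sum>a\<in>B. (\<phi> a s)\<^sup>2)" for s
  define \<psi>' where "\<psi>' s = (\<Sum>a\<in>B. 2 * \<phi> a s * D a s)" for s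
  \<comment> \<open>The factor \<open>card B\<close> arises from Cauchy-Schwarz against the constant
    family 1, the factor 2 from differentiating squares; \<open>\<bar>K\<bar>\<close> guards against
    negative \<open>K\<close>.\<close>
  define L where "L = 2 * \<bar>K\<bar> * real (card B)"
  have bound': "\<bar>\<psi>' s\<bar> \<le> L * \<psi> s" if s: "s \<in> J" for s
  proof -
    let ?\<Phi> = "\<Sum>b\<in>B. \<bar>\<phi> b s\<bar>"
    have "\<bar>\<psi>' s\<bar> \<le> (\<Sum>a\<in>B. \<bar>2 * \<phi> a s * D a s\<bar>)"
      unfolding \<psi>'_def by (rule sum_abs)
    also have "\<dots> \<le> (\<Sum>a\<in>B. 2 * \<bar>\<phi> a s\<bar> * (\<bar>K\<bar> * ?\<Phi>))"
    proof (rule sum_mono)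
      fix a assume a: "a \<in> B"
      have "\<bar>D a s\<bar> \<le> K * ?\<Phi>" by (rule bound[OF a s])
      also have "\<dots> \<le> \<bar>K\<bar> * ?\<Phi>" by (intro mult_right_mono sum_nonneg) auto
      finally show "\<bar>2 * \<phi> a s * D a s\<bar> \<le> 2 * \<bar>\<phi> a s\<bar> * (\<bar>K\<bar> * ?\<Phi>)"
        by (simp add: abs_mult mult_left_mono)
    qed
    also have "\<dots> = 2 * \<bar>K\<bar> * (?\<Phi>)\<^sup>2"
      by (simp add: sum_distrib_left sum_distrib_right power2_eq_square mult_ac)
    also have "(?\<Phi>)\<^sup>2 \<le> (\<Sum>b\<in>B. (1::real)\<^sup>2) * (\<Sum>b\<in>B. \<bar>\<phi> b s\<bar>\<^sup>2)"
      using Cauchy_Schwarz_ineq_sum[of "\<lambda>_. 1" "\<lambda>b. \<bar>\<phi> b s\<bar>" B] by simp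
    then have "2 * \<bar>K\<bar> * (?\<Phi>)\<^sup>2 \<le> 2 * \<bar>K\<bar> * (real (card B) * \<psi> s)"
      by (intro mult_left_mono) (auto simp: \<psi>_def)
    finally show ?thesis by (simp add: L_def mult_ac)
  qed
  have \<psi>: "(\<psi> has_real_derivative \<psi>' s) (at s within J)" if "s \<in> J" for s
    unfolding \<psi>_def[abs_def] \<psi>'_def
    by (rule DERIV_sum) (auto intro!: derivative_eq_intros deriv that)
  \<comment> \<open>Used with \<open>k = - L\<close> after \<open>t\<^sub>1\<close> and with
    \<open>k = L\<close> before it, where \<open>bound'\<close> fixes the sign of the
    bracket.\<close>
  have mvt: "\<exists>s\<in>{p..q}. exp (k * q) * \<psi> q - exp (k * p) * \<psi> p = exp (k * s) * (\<psi>' s + k * \<psi> s) * (q - p)"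
    if "p \<le> q" "p \<in> J" "q \<in> J" for p q k
  proof -
    have sub: "{p..q} \<subseteq> J"
      using J that unfolding is_interval_1 by (meson atLeastAtMost_iff subsetI)
    have "((\<lambda>s. exp (k * s) * \<psi> s) has_real_derivative exp (k * s) * (\<psi>' s + k * \<psi> s)) (at s within {p..q})"
      if "s \<in> {p..q}" for s
    proof -
      have "(\<psi> has_real_derivative \<psi>' s) (at s within {p..q})"
        using has_field_derivative_subset[OF \<psi> sub] sub that by blast
      then show ?thesis by (auto intro!: derivative_eq_intros simp: algebra_simps)
    qed
    then show ?thesis
      by (intro mvt_very_simple[OF \<open>p \<le> q\<close>]) (auto simp: has_field_derivative_def)
  qed
  have \<psi>1: "\<psi> t\<^sub>1 = 0" using zero by (simp add: \<psi>_def)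
  have in_J: "s \<in> J" if "s \<in> {p..q}" "p \<in> J" "q \<in> J" for s p q
    using J that unfolding is_interval_1 by (meson atLeastAtMost_iff)
  have "\<psi> t \<le> 0"
  proof (cases "t\<^sub>1 \<le> t")
    case True
    obtain s where s: "s \<in> {t\<^sub>1..t}"
      "exp (- L * t) * \<psi> t - exp (- L * t\<^sub>1) * \<psi> t\<^sub>1 = exp (- L * s) * (\<psi>' s + - L * \<psi> s) * (t - t\<^sub>1)"
      using mvt[OF True t] by blast
    have "\<psi>' s + - L * \<psi> s \<le> 0" using bound'[OF in_J[OF s(1) t]] by linarith
    then have "exp (- L * s) * (\<psi>' s + - L * \<psi> s) * (t - t\<^sub>1) \<le> 0"
      using True by (intro mult_nonpos_nonneg mult_nonneg_nonpos) auto
    then have "exp (- L * t) * \<psi> t \<le> 0" using s(2) \<psi>1 by simp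
    then show ?thesis by (simp add: mult_le_0_iff)
  next
    case False
    then have le: "t \<le> t\<^sub>1" by simp
    obtain s where s: "s \<in> {t..t\<^sub>1}"
      "exp (L * t\<^sub>1) * \<psi> t\<^sub>1 - exp (L * t) * \<psi> t = exp (L * s) * (\<psi>' s + L * \<psi> s) * (t\<^sub>1 - t)"
      using mvt[OF le t(2,1)] by blast
    have "\<psi>' s + L * \<psi> s \<ge> 0" using bound'[OF in_J[OF s(1) t(2,1)]] by linarith
    then have "exp (L * s) * (\<psi>' s + L * \<psi> s) * (t\<^sub>1 - t) \<ge> 0"
      using le by (intro mult_nonneg_nonneg) auto
    then have "exp (L * t) * \<psi> t \<le> 0" using s(2) \<psi>1 by simp
    then show ?thesis by (simp add: mult_le_0_iff)
  qed
  moreover have "(\<phi> a t)\<^sup>2 \<le> \<psi> t"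
    unfolding \<psi>_def by (rule member_le_sum[OF a]) (use fin in auto)
  ultimately show ?thesis by (smt (verit) power2_less_eq_zero_iff)
qed


section \<open>Momenta along geodesics\<close>

locale riemannian_manifold = smooth_manifold A
  for A :: "('a::{t2_space, second_countable_topology}, 'e::{real_inner, heine_borel}) chart set" +
  fixes g :: "('a, 'e) bilinear_field"
  assumes metric: "riemannian_metric A g"
begin

abbreviation G :: "('a, 'e) chart \<Rightarrow> 'e \<Rightarrow> 'e \<Rightarrow> 'e \<Rightarrow> real" where
  "G \<equiv> metric_in_chart A g"

abbreviation dG :: "('a, 'e) chart \<Rightarrow> 'e \<Rightarrow> 'e \<Rightarrow> 'e \<Rightarrow> 'e \<Rightarrow> real" where
  "dG c x u w \<equiv> frechet_derivative (\<lambda>y. G c y u w) (at x)"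

lemma g_left:
  assumes "u \<in> tangent_space A q" "v \<in> tangent_space A q" "w \<in> tangent_space A q"
  shows "g q (\<lambda>c. a *\<^sub>R u c + b *\<^sub>R v c) w = a * g q u w + b * g q v w"
  using metric assms unfolding riemannian_metric_def by blast

lemma g_sym: "v \<in> tangent_space A q \<Longrightarrow> w \<in> tangent_space A q \<Longrightarrow> g q v w = g q w v"
  using metric unfolding riemannian_metric_def by blast

lemma g_pos: "v \<in> tangent_space A q \<Longrightarrow> v \<noteq> (\<lambda>c. 0) \<Longrightarrow> g q v v > 0"
  using metric unfolding riemannian_metric_def by blast

lemma g_sum_right:
  fixes N :: nat
  assumes v: "v \<in> tangent_space A q" and Z: "\<And>a. a < N \<Longrightarrow> Z a \<in> tangent_space A q"
  shows "g q v (\<lambda>c. \<Sum>a<N. k a *\<^sub>R Z a c) = (\<Sum>a<N. k a * g q v (Z a))"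
proof -
  \<comment> \<open>The induction runs in the first slot, where \<open>g_left\<close> gives
    linearity, and carries tangency along because \<open>g_left\<close> speaks of tangent vectors
    only.\<close>
  have "(\<lambda>c. \<Sum>a<N. k a *\<^sub>R Z a c) \<in> tangent_space A q \<and>
      g q (\<lambda>c. \<Sum>a<N. k a *\<^sub>R Z a c) v = (\<Sum>a<N. k a * g q (Z a) v)"
    using Z
  proof (induction N)
    case 0
    then show ?case
      using g_left[of v q v v 0 0] v tangent_space_zero by simp
  next
    case (Suc N)
    let ?S = "\<lambda>c. \<Sum>a<N. k a *\<^sub>R Z a c"
    have S: "?S \<in> tangent_space A q" "g q ?S v = (\<Sum>a<N. k a * g q (Z a) v)"
      using Suc by auto
    have ZN: "Z N \<in> tangent_space A q" using Suc.prems by simp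
    show ?case
      using tangent_space_combination[OF S(1) ZN, of 1 "k N"] g_left[OF S(1) ZN v, of 1 "k N"] S(2)
      by simp
  qed
  then show "g q v (\<lambda>c. \<Sum>a<N. k a *\<^sub>R Z a c) = (\<Sum>a<N. k a * g q v (Z a))"
    using g_sym[OF v] Z by auto
qed

lemma g_eq_G:
  assumes "c \<in> A" "q \<in> cdom c" "v \<in> tangent_space A q" "w \<in> tangent_space A q"
  shows "g q v w = G c (cmap c q) (v c) (w c)"
  using assms by (simp add: metric_in_chart_def cinv_cmap tvec_components)

lemma G_sym: "c \<in> A \<Longrightarrow> x \<in> cran c \<Longrightarrow> G c x u w = G c x w u"
  unfolding metric_in_chart_def by (intro g_sym tvec_in_tangent_space cinv_in)

lemma linear_G_left:
  assumes "c \<in> A" "x \<in> cran c"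
  shows "linear (\<lambda>u. G c x u w)"
proof (rule linearI)
  note q = assms(1) cinv_in[OF assms]
  note T = tvec_in_tangent_space[OF q]
  show "G c x (u + v) w = G c x u w + G c x v w" for u v
    using tvec_combination[OF q, of 1 u 1 v] g_left[OF T[of u] T[of v] T[of w], of 1 1]
    by (simp add: metric_in_chart_def)
  show "G c x (r *\<^sub>R u) w = r *\<^sub>R G c x u w" for r u
    using tvec_combination[OF q, of r u 0 u] g_left[OF T[of u] T[of u] T[of w], of r 0]
    by (simp add: metric_in_chart_def)
qed

lemma linear_G_right:
  assumes "c \<in> A" "x \<in> cran c"
  shows "linear (G c x u)"
proof -
  have "G c x u = (\<lambda>w. G c x w u)" using G_sym[OF assms] by blast
  then show ?thesis using linear_G_left[OF assms] by simp
qed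

lemma G_pos:
  assumes "c \<in> A" "x \<in> cran c" "u \<noteq> 0"
  shows "G c x u u > 0"
proof -
  have q: "cinv c x \<in> cdom c" by (rule cinv_in[OF assms(1,2)])
  have "tvec A c (cinv c x) u \<noteq> (\<lambda>d. 0)"
    using tvec_self[OF assms(1) q, of u] assms(3) by auto
  then show ?thesis
    unfolding metric_in_chart_def by (rule g_pos[OF tvec_in_tangent_space[OF assms(1) q]])
qed

lemma G_has_deriv:
  assumes "c \<in> A" "x \<in> cran c"
  shows "((\<lambda>y. G c y u w) has_derivative dG c x u w) (at x)"
  using metric assms smooth_onD unfolding riemannian_metric_def by blast

lemma linear_dG:
  assumes "c \<in> A" "x \<in> cran c"
  shows "linear (dG c x u w)" "linear (\<lambda>w. dG c x u w a)" "linear (\<lambda>u. dG c x u w a)"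
proof -
  note S = open_cran[OF assms(1)] assms(2)
  show "linear (dG c x u w)"
    by (rule has_derivative_linear[OF G_has_deriv[OF assms]])
  show "linear (\<lambda>w. dG c x u w a)"
    by (rule linear_family_derivative[OF S linear_G_right[OF assms(1)] G_has_deriv[OF assms]])
  show "linear (\<lambda>u. dG c x u w a)"
    by (rule linear_family_derivative[OF S linear_G_left[OF assms(1)] G_has_deriv[OF assms]])
qed

text \<open>Resolves the definite description: the right-hand side is linear in \<open>v\<close> by
  \<open>linear_dG\<close>, so \<open>riesz_pos_def\<close> provides the unique vector representing
  it.\<close>

lemma christoffel:
  assumes "c \<in> A" "x \<in> cran c"
  shows "G c x (christoffel A g c x u w) v = (dG c x w v u + dG c x u v w - dG c x u w v) / 2"
proof -
  have "linear (\<lambda>v. (dG c x w v u + dG c x u v w - dG c x u w v) / 2)"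
    by (rule linearI) (simp_all add: linear_add[OF linear_dG(1)[OF assms]] linear_add[OF linear_dG(2)[OF assms]]
        linear_scale[OF linear_dG(1)[OF assms]] linear_scale[OF linear_dG(2)[OF assms]]
        linear_add[OF linear_dG(3)[OF assms]] linear_scale[OF linear_dG(3)[OF assms]] field_simps)
  from theI'[OF riesz_pos_def[OF linear_G_left[OF assms] linear_G_right[OF assms] G_pos[OF assms] this]]
  show ?thesis unfolding christoffel_def by blast
qed

lemma G_has_derivative_along:
  assumes c: "c \<in> A" and T: "t \<in> T" and x: "(x has_derivative x') (at t within T)" "x t \<in> cran c"
    and u: "(u has_derivative u') (at t within T)" and w: "(w has_derivative w') (at t within T)"
  shows "((\<lambda>s. G c (x s) (u s) (w s)) has_derivative
    (\<lambda>r. dG c (x t) (u t) (w t) (x' r) + G c (x t) (u' r) (w t) + G c (x t) (u t) (w' r))) (at t within T)"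
proof -
  have "(x \<longlongrightarrow> x t) (at t within T)"
    using has_derivative_continuous[OF x(1)] by (simp add: continuous_within)
  from topological_tendstoD[OF this open_cran[OF c] x(2)]
  have ev: "\<forall>\<^sub>F s in at t within T. x s \<in> cran c" .
  have "((\<lambda>s. G c (x s) b b') has_derivative (\<lambda>r. dG c (x t) b b' (x' r))) (at t within T)" for b b'
    by (rule has_derivative_compose[OF x(1) G_has_deriv[OF c x(2)]])
  \<comment> \<open>The first vector slot varies while the second is frozen at \<open>b'\<close>;
    the final step then lets the second one vary.\<close>
  then have 1: "((\<lambda>s. G c (x s) (u s) b') has_derivative
      (\<lambda>r. dG c (x t) (u t) b' (x' r) + G c (x t) (u' r) b')) (at t within T)" for b'
    by (intro has_derivative_linear_family[OF T _ _ _ _ u, where h = "\<lambda>s b. G c (x s) b b'"]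
        linear_G_left[OF c x(2)] linear_dG[OF c x(2)] eventually_mono[OF ev linear_G_left[OF c]])
  show ?thesis
    by (intro has_derivative_linear_family[OF T _ _ _ 1 w] linear_compose_add
        linear_G_right[OF c x(2)] linear_dG[OF c x(2)] eventually_mono[OF ev linear_G_right[OF c]])
qed

text \<open>As \<open>V\<close> is constant to first order at \<open>q\<close>, differentiating g(V,
  V) only hits the metric coefficients, and the bracket reduces to minus the derivative of
  \<open>X\<close> along \<open>V\<close>. The two bracket terms agree by symmetry, whence the
  factor 2.\<close>

lemma lie_derivative_metric_diagonal:
  assumes X: "X \<in> vector_fields A" and V: "V \<in> vector_fields A" and c: "c = chart_at A q"
    and V0: "((\<lambda>x. V (cinv c x) c) has_derivative (\<lambda>a. 0)) (at (cmap c q))"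
  shows "lie_derivative_metric A X g V V q = dG c (cmap c q) (V q c) (V q c) (X q c)
    + 2 * G c (cmap c q) (V q c) (frechet_derivative (\<lambda>x. X (cinv c x) c) (at (cmap c q)) (V q c))"
proof -
  have c1: "c \<in> A" "q \<in> cdom c" using chart_at c by auto
  let ?x = "cmap c q" and ?v = "V q c"
  have x: "?x \<in> cran c" using c1 by simp
  have "((\<lambda>x. G c x (V (cinv c x) c) (V (cinv c x) c)) has_derivative dG c ?x ?v ?v) (at ?x)"
    using G_has_derivative_along[OF c1(1) UNIV_I has_derivative_ident x V0 V0]
    by (simp add: cinv_cmap c1 linear_0[OF linear_G_left[OF c1(1) x]] linear_0[OF linear_G_right[OF c1(1) x]])
  then have "((\<lambda>x. g (cinv c x) (V (cinv c x)) (V (cinv c x))) has_derivative dG c ?x ?v ?v) (at ?x)"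
    by (rule has_derivative_transform_within_open[OF _ open_cran[OF c1(1)] x])
      (auto simp: g_eq_G[OF c1(1)] cinv_cmap c1 vector_field_tangent[OF V])
  then have 1: "directional_derivative A (\<lambda>p. g p (V p) (V p)) q (X q) = dG c ?x ?v ?v (X q c)"
    unfolding directional_derivative_def c[symmetric] Let_def by (simp add: frechet_eqI)
  let ?d = "frechet_derivative (\<lambda>x. X (cinv c x) c) (at ?x) ?v"
  have "lie_bracket A X V q c = - ?d"
    using c1 by (simp add: lie_bracket_def frechet_eqI[OF V0])
  then have 2: "g q (lie_bracket A X V q) (V q) = - G c ?x ?d ?v"
    using g_eq_G[OF c1 lie_bracket_in_tangent_space[OF X V] vector_field_tangent[OF V]]
      linear_neg[OF linear_G_left[OF c1(1) x]] by simp
  have 3: "g q (V q) (lie_bracket A X V q) = g q (lie_bracket A X V q) (V q)"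
    by (intro g_sym lie_bracket_in_tangent_space vector_field_tangent X V)
  show ?thesis
    unfolding lie_derivative_metric_def 1 2 3 using G_sym[OF c1(1) x, of ?d ?v] by simp
qed

end

locale riemannian_geodesic = riemannian_manifold A g
  for A :: "('a::{t2_space, second_countable_topology}, 'e::{real_inner, heine_borel}) chart set"
    and g :: "('a, 'e) bilinear_field" +
  fixes I :: "real set" and \<gamma> :: "real \<Rightarrow> 'a"
  assumes geo: "geodesic A g I \<gamma>"
begin

lemma geodesic_tendsto: "t \<in> I \<Longrightarrow> (\<gamma> \<longlongrightarrow> \<gamma> t) (at t within I)"
  using geo by (auto simp: geodesic_def continuous_on_def)

lemma geodesic_has_deriv:
  assumes "t \<in> I" "c \<in> A" "\<gamma> t \<in> cdom c"
  shows "((\<lambda>s. cmap c (\<gamma> s)) has_vector_derivative velocity A I \<gamma> t c) (at t within I)"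
    and "((\<lambda>s. velocity A I \<gamma> s c) has_vector_derivative
      - christoffel A g c (cmap c (\<gamma> t)) (velocity A I \<gamma> t c) (velocity A I \<gamma> t c)) (at t within I)"
  using geo assms unfolding geodesic_def by blast+

lemma eventually_in_open:
  "t \<in> I \<Longrightarrow> open U \<Longrightarrow> \<gamma> t \<in> U \<Longrightarrow> \<forall>\<^sub>F s in at t within I. \<gamma> s \<in> U"
  using topological_tendstoD[OF geodesic_tendsto] by blast

text \<open>A connected set with more than one point has no isolated points. This gives uniqueness
  of derivatives within \<open>I\<close>, end points included.\<close>

lemma at_within_interval_nontrivial:
  assumes "t \<in> I"
  shows "at t within I \<noteq> bot"
proof -
  have "I \<noteq> {t}" using geo by (auto simp: geodesic_def)
  moreover have "connected I" using geo by (simp add: geodesic_def is_interval_connected)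
  ultimately have "t islimpt I" using assms connected_imp_perfect by (metis singletonD)
  then show ?thesis by (simp add: trivial_limit_within)
qed

text \<open>\<open>velocity\<close> is defined chart by chart. The chain rule gives a second
  derivative of the same coordinate curve in \<open>d\<close>, and uniqueness identifies the
  two.\<close>

lemma velocity_in_tangent_space:
  assumes t: "t \<in> I"
  shows "velocity A I \<gamma> t \<in> tangent_space A (\<gamma> t)"
proof -
  have "velocity A I \<gamma> t d = transition_deriv c d (cmap c (\<gamma> t)) (velocity A I \<gamma> t c)"
    if c: "c \<in> A" "\<gamma> t \<in> cdom c" and d: "d \<in> A" "\<gamma> t \<in> cdom d" for c d
  proof -
    have "((\<lambda>s. (cmap d \<circ> cinv c) (cmap c (\<gamma> s))) has_vector_derivative
        transition_deriv c d (cmap c (\<gamma> t)) (velocity A I \<gamma> t c)) (at t within I)"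
      using has_derivative_compose[OF geodesic_has_deriv(1)[OF t c, unfolded has_vector_derivative_def]
          transition_has_deriv[OF c(1) d(1) c(2) d(2)]]
        linear_scale[OF has_derivative_linear[OF transition_has_deriv[OF c(1) d(1) c(2) d(2)]]]
      by (simp add: has_vector_derivative_def)
    then have "((\<lambda>s. cmap d (\<gamma> s)) has_vector_derivative
        transition_deriv c d (cmap c (\<gamma> t)) (velocity A I \<gamma> t c)) (at t within I)"
      unfolding has_vector_derivative_def
      by (rule has_derivative_transform_eventually)
        (use eventually_in_open[OF t open_cdom[OF c(1)] c(2)] c t in
          \<open>auto simp: cinv_cmap elim!: eventually_mono\<close>)
    from vector_derivative_unique_within[OF at_within_interval_nontrivial[OF t] geodesic_has_deriv(1)[OF t d] this]
    show ?thesis .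
  qed
  moreover have "velocity A I \<gamma> t c = 0" if "\<not> (c \<in> A \<and> \<gamma> t \<in> cdom c)" for c
    using that by (auto simp: velocity_def)
  ultimately show ?thesis unfolding tangent_space_def by blast
qed

text \<open>
  The field \<open>V\<close> extending the velocity is constant to first order in the chart \<open>c\<close>, so that in
  \<open>\<L>\<^sub>X g\<close> only derivatives of \<open>g\<close> and \<open>X\<close> remain; \<open>c\<close> is the chart that \<open>directional_derivative\<close> selects.
\<close>

lemma momentum_has_deriv:
  assumes X: "X \<in> vector_fields A" and t: "t \<in> I"
  shows "\<exists>V\<in>vector_fields A. V (\<gamma> t) = velocity A I \<gamma> t \<and>
    ((\<lambda>s. g (\<gamma> s) (velocity A I \<gamma> s) (X (\<gamma> s))) has_real_derivative
      lie_derivative_metric A X g V V (\<gamma> t) / 2) (at t within I)"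
proof -
  define c where c: "c = chart_at A (\<gamma> t)"
  have c1: "c \<in> A" "\<gamma> t \<in> cdom c" using chart_at c by auto
  let ?x = "\<lambda>s. cmap c (\<gamma> s)" and ?v = "\<lambda>s. velocity A I \<gamma> s c" and ?X = "\<lambda>s. X (\<gamma> s) c"
  let ?D = "frechet_derivative (\<lambda>x. X (cinv c x) c) (at (?x t))"
  let ?\<Gamma> = "christoffel A g c (?x t) (?v t) (?v t)"
  have x: "?x t \<in> cran c" using c1 by simp
  obtain V where V: "V \<in> vector_fields A" "V (\<gamma> t) = velocity A I \<gamma> t"
    "((\<lambda>x. V (cinv c x) c) has_derivative (\<lambda>a. 0)) (at (?x t))"
    using ex_vector_field[OF c1 velocity_in_tangent_space[OF t]] .
  note dx = geodesic_has_deriv(1)[OF t c1, unfolded has_vector_derivative_def]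
  note dv = geodesic_has_deriv(2)[OF t c1, unfolded has_vector_derivative_def]
  have ev: "\<forall>\<^sub>F s in at t within I. \<gamma> s \<in> cdom c"
    by (rule eventually_in_open[OF t open_cdom[OF c1(1)] c1(2)])
  have "((\<lambda>s. X (cinv c (?x s)) c) has_derivative (\<lambda>r. ?D (r *\<^sub>R ?v t))) (at t within I)"
    by (rule has_derivative_compose[OF dx vector_field_has_deriv[OF X c1]])
  from G_has_derivative_along[OF c1(1) t dx x dv this]
  have "((\<lambda>s. G c (?x s) (?v s) (X (cinv c (?x s)) c)) has_real_derivative
      dG c (?x t) (?v t) (?X t) (?v t) + G c (?x t) (- ?\<Gamma>) (?X t) + G c (?x t) (?v t) (?D (?v t))) (at t within I)"
    unfolding has_field_derivative_def
    by (rule has_derivative_eq_rhs)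
      (auto simp: cinv_cmap c1 linear_scale[OF linear_dG(1)[OF c1(1) x]]
        linear_scale[OF linear_G_left[OF c1(1) x]] linear_scale[OF linear_G_right[OF c1(1) x]]
        linear_scale[OF has_derivative_linear[OF vector_field_has_deriv[OF X c1]]]
        linear_neg[OF linear_G_left[OF c1(1) x]] algebra_simps)
  \<comment> \<open>By \<open>christoffel\<close>, the acceleration term cancels the derivative of
    the metric along the velocity and leaves half of its derivative along \<open>X\<close>.\<close>
  also have "dG c (?x t) (?v t) (?X t) (?v t) + G c (?x t) (- ?\<Gamma>) (?X t) + G c (?x t) (?v t) (?D (?v t)) =
      lie_derivative_metric A X g V V (\<gamma> t) / 2"
    unfolding lie_derivative_metric_diagonal[OF X V(1) c V(3)] linear_neg[OF linear_G_left[OF c1(1) x]]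
      christoffel[OF c1(1) x] V(2) by (simp add: field_simps)
  finally have "((\<lambda>s. g (\<gamma> s) (velocity A I \<gamma> s) (X (\<gamma> s))) has_real_derivative
      lie_derivative_metric A X g V V (\<gamma> t) / 2) (at t within I)"
    unfolding has_field_derivative_def
  proof (rule has_derivative_transform_eventually)
    have eq: "G c (?x s) (?v s) (X (cinv c (?x s)) c) = g (\<gamma> s) (velocity A I \<gamma> s) (X (\<gamma> s))"
      if "s \<in> I" "\<gamma> s \<in> cdom c" for s
      using g_eq_G[OF c1(1) that(2) velocity_in_tangent_space[OF that(1)] vector_field_tangent[OF X]]
      by (simp add: cinv_cmap c1 that)
    show "\<forall>\<^sub>F s in at t within I. G c (?x s) (?v s) (X (cinv c (?x s)) c) =
        g (\<gamma> s) (velocity A I \<gamma> s) (X (\<gamma> s))"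
      using ev eventually_at_topological[of "\<lambda>s. s \<in> I" t I] eq by (auto simp: eventually_at_filter elim!: eventually_mono)
    show "G c (?x t) (?v t) (X (cinv c (?x t)) c) = g (\<gamma> t) (velocity A I \<gamma> t) (X (\<gamma> t))"
      by (rule eq[OF t c1(2)])
  qed (rule t)
  with V show ?thesis by blast
qed

text \<open>Provides local boundedness of the coefficients in the differential system. A one-form is
  known to be smooth on constant coordinate vectors, so the velocity is expanded in the
  basis.\<close>

lemma one_form_velocity_tendsto:
  assumes \<omega>: "\<omega> \<in> one_forms A" and t: "t \<in> I"
  shows "((\<lambda>s. \<omega> (\<gamma> s) (velocity A I \<gamma> s)) \<longlongrightarrow> \<omega> (\<gamma> t) (velocity A I \<gamma> t)) (at t within I)"
proof -
  obtain c where c: "c \<in> A" "\<gamma> t \<in> cdom c" using ex_chart by blast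
  let ?w = "\<lambda>x u. \<omega> (cinv c x) (tvec A c (cinv c x) u)"
  have lin: "linear (?w x)" if x: "x \<in> cran c" for x
  proof (rule linearI)
    note q = c(1) cinv_in[OF c(1) x]
    note T = tvec_in_tangent_space[OF q]
    have comb: "\<omega> (cinv c x) (\<lambda>d. a *\<^sub>R tvec A c (cinv c x) u d + b *\<^sub>R tvec A c (cinv c x) v d) =
        a * ?w x u + b * ?w x v" for a b u v
      using \<omega> T unfolding one_forms_def by blast
    show "?w x (u + v) = ?w x u + ?w x v" for u v
      using tvec_combination[OF q, of 1 u 1 v] comb[of 1 u 1 v] by simp
    show "?w x (r *\<^sub>R u) = r *\<^sub>R ?w x u" for r u
      using tvec_combination[OF q, of r u 0 u] comb[of r u 0 u] by simp
  qed
  have eq: "(\<Sum>b\<in>onb. (velocity A I \<gamma> s c \<bullet> b) *\<^sub>R ?w (cmap c (\<gamma> s)) b) = \<omega> (\<gamma> s) (velocity A I \<gamma> s)"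
    if "s \<in> I" "\<gamma> s \<in> cdom c" for s
    using linear_onb[OF lin, of "cmap c (\<gamma> s)" "velocity A I \<gamma> s c"] that c
    by (simp add: cinv_cmap tvec_components velocity_in_tangent_space)
  have x: "((\<lambda>s. cmap c (\<gamma> s)) \<longlongrightarrow> cmap c (\<gamma> t)) (at t within I)"
    and v: "((\<lambda>s. velocity A I \<gamma> s c) \<longlongrightarrow> velocity A I \<gamma> t c) (at t within I)"
    using geodesic_has_deriv[OF t c, THEN has_vector_derivative_continuous]
    by (simp_all add: continuous_within)
  have "isCont (\<lambda>x. ?w x b) (cmap c (\<gamma> t))" for b
  proof -
    have "continuous_on (cran c) (\<lambda>x. ?w x b)"
      using \<omega> c unfolding one_forms_def by (blast intro: smooth_on_continuous)
    then show ?thesis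
      using open_cran c by (auto simp: continuous_on_eq_continuous_at)
  qed
  then have "((\<lambda>s. \<Sum>b\<in>onb. (velocity A I \<gamma> s c \<bullet> b) *\<^sub>R ?w (cmap c (\<gamma> s)) b) \<longlongrightarrow>
      (\<Sum>b\<in>onb. (velocity A I \<gamma> t c \<bullet> b) *\<^sub>R ?w (cmap c (\<gamma> t)) b)) (at t within I)"
    by (intro tendsto_sum tendsto_scaleR tendsto_inner v tendsto_const isCont_tendsto_compose[OF _ x])
  then show ?thesis
    unfolding eq[OF t c(2)]
    by (rule Lim_transform_eventually)
      (use eventually_in_open[OF t open_cdom[OF c(1)] c(2)] eq in
        \<open>auto simp: eventually_at_filter elim!: eventually_mono\<close>)
qed

end


section \<open>Singular Riemannian foliations\<close>

lemma (in smooth_manifold) foliation_local_generators: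
  assumes F: "singular_foliation A F"
  obtains N :: nat and Z \<rho> where "\<rho> \<in> smooth_functions A" "\<rho> q = 1" "\<And>a. a < N \<Longrightarrow> Z a \<in> F"
    "\<And>Y. Y \<in> F \<Longrightarrow> \<exists>f. (\<forall>a<N. f a \<in> smooth_functions A) \<and>
      (\<forall>p. (\<lambda>c. (\<rho> p)\<^sup>2 *\<^sub>R Y p c) = (\<lambda>c. \<Sum>a<N. f a p *\<^sub>R Z a p c))"
proof -
  have "\<exists>U (N::nat) X. open U \<and> q \<in> U \<and> (\<forall>a<N. X a \<in> vector_fields_on A U) \<and>
        {Z \<in> F. vsupport Z \<subseteq> U} =
        {(\<lambda>p c. \<Sum>a<N. f a p *\<^sub>R X a p c) |f. \<forall>a<N. f a \<in> compactly_supported_functions A U}"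
    using F unfolding singular_foliation_def by blast
  then obtain U N X where U: "open U" "q \<in> U" and gen: "{Z \<in> F. vsupport Z \<subseteq> U} =
      {(\<lambda>p c. \<Sum>a<(N::nat). f a p *\<^sub>R X a p c) |f. \<forall>a<N. f a \<in> compactly_supported_functions A U}"
    by blast
  obtain c where c: "c \<in> A" "q \<in> cdom c" using ex_chart by blast
  obtain \<rho> where \<rho>: "\<rho> \<in> compactly_supported_functions A (cdom c \<inter> U)" "\<rho> q = 1"
    using ex_bump[OF c U] .
  have \<rho>s: "\<rho> \<in> smooth_functions A" and \<rho>U: "\<rho> \<in> compactly_supported_functions A U"
    and supp: "closure {p. \<rho> p \<noteq> 0} \<subseteq> U"
    using \<rho>(1) by (auto simp: compactly_supported_functions_def)
  define Z where "Z a = (\<lambda>p c. \<rho> p *\<^sub>R X a p c)" for a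
  have "Z a \<in> F" if "a < N" for a
  proof -
    \<comment> \<open>Coefficients selecting the single generator \<open>X a\<close>, with weight
      \<open>\<rho>\<close>.\<close>
    let ?f = "\<lambda>b. if b = a then \<rho> else (\<lambda>_. 0)"
    have "(\<lambda>_. 0) \<in> compactly_supported_functions A U"
      by (simp add: compactly_supported_functions_def smooth_functions_def smooth_on_const)
    then have "(\<lambda>p c. \<Sum>b<N. ?f b p *\<^sub>R X b p c) \<in> {Z \<in> F. vsupport Z \<subseteq> U}"
      unfolding gen using \<rho>U by (auto intro!: exI[of _ ?f])
    moreover have "(\<lambda>p c. \<Sum>b<N. ?f b p *\<^sub>R X b p c) = Z a"
    proof (intro ext)
      fix p c
      have "(\<Sum>b<N. ?f b p *\<^sub>R X b p c) = (\<Sum>b<N. if b = a then \<rho> p *\<^sub>R X a p c else 0)"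
        by (rule sum.cong) auto
      then show "(\<Sum>b<N. ?f b p *\<^sub>R X b p c) = Z a p c"
        using that by (simp add: Z_def)
    qed
    ultimately show ?thesis by simp
  qed
  moreover have "\<exists>f. (\<forall>a<N. f a \<in> smooth_functions A) \<and>
      (\<forall>p. (\<lambda>c. (\<rho> p)\<^sup>2 *\<^sub>R Y p c) = (\<lambda>c. \<Sum>a<N. f a p *\<^sub>R Z a p c))" if Y: "Y \<in> F" for Y
  proof -
    have "(\<lambda>p c. \<rho> p *\<^sub>R Y p c) \<in> F"
      using F Y \<rho>s unfolding singular_foliation_def by blast
    moreover have "vsupport (\<lambda>p c. \<rho> p *\<^sub>R Y p c) \<subseteq> U"
    proof -
      have "{p. (\<lambda>c. \<rho> p *\<^sub>R Y p c) \<noteq> (\<lambda>c. 0)} \<subseteq> {p. \<rho> p \<noteq> 0}" by auto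
      then show ?thesis using supp closure_mono unfolding vsupport_def by blast
    qed
    ultimately have "(\<lambda>p c. \<rho> p *\<^sub>R Y p c) \<in> {Z \<in> F. vsupport Z \<subseteq> U}" by blast
    then obtain f where f: "(\<lambda>p c. \<rho> p *\<^sub>R Y p c) = (\<lambda>p c. \<Sum>a<N. f a p *\<^sub>R X a p c)"
      "\<forall>a<N. f a \<in> compactly_supported_functions A U"
      unfolding gen by blast
    have "(\<rho> p)\<^sup>2 *\<^sub>R Y p c = (\<Sum>a<N. f a p *\<^sub>R Z a p c)" for p c
    proof -
      have "(\<rho> p)\<^sup>2 *\<^sub>R Y p c = \<rho> p *\<^sub>R (\<Sum>a<N. f a p *\<^sub>R X a p c)"
        using fun_cong[OF fun_cong[OF f(1)], of p c] by (simp add: power2_eq_square flip: scaleR_scaleR)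
      then show ?thesis by (simp add: Z_def scaleR_sum_right mult.commute)
    qed
    then show ?thesis using f(2) by (auto simp: compactly_supported_functions_def)
  qed
  ultimately show thesis using that \<rho>s \<rho>(2) by blast
qed

context riemannian_geodesic
begin

abbreviation momentum :: "('a, 'e) vfield \<Rightarrow> real \<Rightarrow> real" where
  "momentum X s \<equiv> g (\<gamma> s) (velocity A I \<gamma> s) (X (\<gamma> s))"

text \<open>The field extending the velocity changes with \<open>t\<close>, but \<open>N\<close>,
  \<open>\<omega>\<close> and \<open>Y\<close> depend on \<open>X\<close> alone, so one formula
  holds along the whole geodesic. On the diagonal \<open>sym_product\<close> becomes a plain
  product.\<close>

lemma module_momentum_deriv:
  assumes M: "module_SRF A g F" and X: "X \<in> F"
  obtains N :: nat and \<omega> Y where "\<And>i. i < N \<Longrightarrow> \<omega> i \<in> one_forms A" "\<And>i. i < N \<Longrightarrow> Y i \<in> F"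
    "\<And>t. t \<in> I \<Longrightarrow> (momentum X has_real_derivative
      (\<Sum>i<N. \<omega> i (\<gamma> t) (velocity A I \<gamma> t) * momentum (Y i) t) / 2) (at t within I)"
proof -
  have FV: "Y \<in> vector_fields A" if "Y \<in> F" for Y
    using M that by (auto simp: module_SRF_def singular_foliation_def compactly_supported_vector_fields_def)
  have "\<exists>(N::nat) \<omega> Y. (\<forall>i<N. \<omega> i \<in> one_forms A \<and> Y i \<in> F) \<and>
        (\<forall>V\<in>vector_fields A. \<forall>W\<in>vector_fields A. \<forall>q.
           lie_derivative_metric A X g V W q =
           (\<Sum>i<N. sym_product (\<omega> i) (flat g (Y i)) q (V q) (W q)))"
    using M X unfolding module_SRF_def by blast
  then obtain N \<omega> Y where *: "\<forall>i<(N::nat). \<omega> i \<in> one_forms A \<and> Y i \<in> F"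
    "\<forall>V\<in>vector_fields A. \<forall>W\<in>vector_fields A. \<forall>q.
           lie_derivative_metric A X g V W q =
           (\<Sum>i<N. sym_product (\<omega> i) (flat g (Y i)) q (V q) (W q))"
    by blast
  have "(momentum X has_real_derivative
      (\<Sum>i<N. \<omega> i (\<gamma> t) (velocity A I \<gamma> t) * momentum (Y i) t) / 2) (at t within I)" if t: "t \<in> I" for t
  proof -
    obtain V where V: "V \<in> vector_fields A" "V (\<gamma> t) = velocity A I \<gamma> t"
      "(momentum X has_real_derivative lie_derivative_metric A X g V V (\<gamma> t) / 2) (at t within I)"
      using momentum_has_deriv[OF FV[OF X] t] by blast
    have "sym_product (\<omega> i) (flat g (Y i)) (\<gamma> t) (V (\<gamma> t)) (V (\<gamma> t)) =
        \<omega> i (\<gamma> t) (velocity A I \<gamma> t) * momentum (Y i) t" if "i < N" for i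
      using g_sym[OF velocity_in_tangent_space[OF t] vector_field_tangent[OF FV]] * that
      by (simp add: sym_product_def flat_def V(2))
    then have "lie_derivative_metric A X g V V (\<gamma> t) =
        (\<Sum>i<N. \<omega> i (\<gamma> t) (velocity A I \<gamma> t) * momentum (Y i) t)"
      using *(2) V(1) by simp
    then show ?thesis using V(3) by simp
  qed
  then show thesis using that * by blast
qed

text \<open>Quantifying over both \<open>s\<close> and \<open>t\<close> in \<open>J\<close> lets
  vanishing spread from any time in \<open>J\<close> to any other, in the form that induction over a
  connected set expects.\<close>

lemma module_momentum_locally_zero:
  assumes M: "module_SRF A g F" and t\<^sub>0: "t\<^sub>0 \<in> I"
  shows "\<exists>J. openin (top_of_set I) J \<and> t\<^sub>0 \<in> J \<and>
    (\<forall>s\<in>J. \<forall>t\<in>J. (\<forall>Y\<in>F. momentum Y s = 0) \<longrightarrow> (\<forall>Y\<in>F. momentum Y t = 0))"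
proof -
  have SF: "singular_foliation A F" using M by (simp add: module_SRF_def)
  have tangent: "Y q \<in> tangent_space A q" if "Y \<in> F" for Y q
    using M that vector_field_tangent
    by (auto simp: module_SRF_def singular_foliation_def compactly_supported_vector_fields_def)
  obtain \<rho> and N :: nat and Z where \<rho>: "\<rho> \<in> smooth_functions A" "\<rho> (\<gamma> t\<^sub>0) = 1"
    and Z: "\<And>a. a < N \<Longrightarrow> Z a \<in> F"
    and gen: "\<And>Y. Y \<in> F \<Longrightarrow> \<exists>f. (\<forall>a<N. f a \<in> smooth_functions A) \<and>
      (\<forall>p. (\<lambda>c. (\<rho> p)\<^sup>2 *\<^sub>R Y p c) = (\<lambda>c. \<Sum>a<N. f a p *\<^sub>R Z a p c))"
    by (rule foliation_local_generators[OF SF, of "\<gamma> t\<^sub>0"]) (rule that)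
  have gen': "\<exists>f. (\<forall>a<N. f a \<in> smooth_functions A) \<and>
      (\<forall>s\<in>I. (\<rho> (\<gamma> s))\<^sup>2 * momentum Y s = (\<Sum>a<N. f a (\<gamma> s) * momentum (Z a) s))" if Y: "Y \<in> F" for Y
  proof -
    obtain f where f: "\<forall>a<N. f a \<in> smooth_functions A"
      "\<And>p. (\<lambda>c. (\<rho> p)\<^sup>2 *\<^sub>R Y p c) = (\<lambda>c. \<Sum>a<N. f a p *\<^sub>R Z a p c)"
      using gen[OF Y] by blast
    have "(\<rho> (\<gamma> s))\<^sup>2 * momentum Y s = (\<Sum>a<N. f a (\<gamma> s) * momentum (Z a) s)" if s: "s \<in> I" for s
    proof -
      note v = velocity_in_tangent_space[OF s]
      have "(\<rho> (\<gamma> s))\<^sup>2 * momentum Y s = g (\<gamma> s) (velocity A I \<gamma> s) (\<lambda>c. (\<rho> (\<gamma> s))\<^sup>2 *\<^sub>R Y (\<gamma> s) c)"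
        using g_sum_right[OF v, of 1 "\<lambda>_. Y (\<gamma> s)" "\<lambda>_. (\<rho> (\<gamma> s))\<^sup>2"] tangent[OF Y] by simp
      also have "\<dots> = (\<Sum>a<N. f a (\<gamma> s) * momentum (Z a) s)"
        unfolding f(2) by (rule g_sum_right[OF v]) (simp add: tangent Z)
      finally show ?thesis .
    qed
    with f(1) show ?thesis by blast
  qed
  define \<Phi> where "\<Phi> s = (\<Sum>a<N. \<bar>momentum (Z a) s\<bar>)" for s
  \<comment> \<open>Unlike \<open>at t\<^sub>0 within I\<close>, this filter includes the point
    \<open>t\<^sub>0\<close>, where the bounds are needed as well.\<close>
  define E where "E = inf (nhds t\<^sub>0) (principal I)"
  have tends_E: "(h \<longlongrightarrow> h t\<^sub>0) E" if "(h \<longlongrightarrow> h t\<^sub>0) (at t\<^sub>0 within I)" for h :: "real \<Rightarrow> real"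
  proof (rule topological_tendstoI)
    fix S assume S: "open S" "h t\<^sub>0 \<in> S"
    from topological_tendstoD[OF that this] show "\<forall>\<^sub>F s in E. h s \<in> S"
      unfolding E_def eventually_inf_principal eventually_at_filter
      by (rule eventually_mono) (use S in auto)
  qed
  have smooth_E: "((\<lambda>s. f (\<gamma> s)) \<longlongrightarrow> f (\<gamma> t\<^sub>0)) E" if "f \<in> smooth_functions A" for f
    using smooth_function_continuous[OF that] geodesic_tendsto[OF t\<^sub>0]
    by (intro tends_E isCont_tendsto_compose[of "\<gamma> t\<^sub>0" f]) (auto simp: continuous_on_eq_continuous_at)
  have \<rho>E: "\<forall>\<^sub>F s in E. \<rho> (\<gamma> s) \<noteq> 0"
    using tendsto_imp_eventually_ne[OF smooth_E[OF \<rho>(1)], of 0] \<rho>(2) by simp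
  have IE: "\<forall>\<^sub>F s in E. s \<in> I" by (simp add: E_def eventually_inf_principal)
  have O1: "h \<in> O[E](\<lambda>_. 1)" if "(h \<longlongrightarrow> L) E" for h :: "real \<Rightarrow> real" and L
    using that by (intro bigoI_tendsto[of _ _ L]) auto
  \<comment> \<open>Near \<open>t\<^sub>0\<close> the cutoff is nonzero, so dividing by its square
    expresses every momentum by those of the generators with bounded coefficients. As an inequality,
    \<open>O[E](\<Phi>)\<close> stays meaningful where \<open>\<Phi>\<close> vanishes.\<close>
  have mom_O: "momentum Y \<in> O[E](\<Phi>)" if Y: "Y \<in> F" for Y
  proof -
    obtain f where f: "\<forall>a<N. f a \<in> smooth_functions A"
      "\<forall>s\<in>I. (\<rho> (\<gamma> s))\<^sup>2 * momentum Y s = (\<Sum>a<N. f a (\<gamma> s) * momentum (Z a) s)"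
      using gen'[OF Y] by blast
    have "(\<lambda>s. \<Sum>a<N. (f a (\<gamma> s) / (\<rho> (\<gamma> s))\<^sup>2) * momentum (Z a) s) \<in> O[E](\<Phi>)"
    proof (rule big_sum_in_bigo)
      fix a assume a: "a \<in> {..<N}"
      have "((\<lambda>s. f a (\<gamma> s) / (\<rho> (\<gamma> s))\<^sup>2) \<longlongrightarrow> f a (\<gamma> t\<^sub>0) / (\<rho> (\<gamma> t\<^sub>0))\<^sup>2) E"
        using f(1) a \<rho> by (intro tendsto_intros smooth_E) auto
      moreover have "momentum (Z a) \<in> O[E](\<Phi>)"
      proof (rule landau_o.bigI[of 1])
        show "\<forall>\<^sub>F s in E. norm (momentum (Z a) s) \<le> 1 * norm (\<Phi> s)"
          using member_le_sum[OF a, of "\<lambda>a. \<bar>momentum (Z a) _\<bar>"]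
          by (auto simp: \<Phi>_def sum_nonneg intro!: always_eventually)
      qed simp
      ultimately show "(\<lambda>s. (f a (\<gamma> s) / (\<rho> (\<gamma> s))\<^sup>2) * momentum (Z a) s) \<in> O[E](\<Phi>)"
        using landau_o.big.mult[OF O1] by fastforce
    qed
    moreover have "\<forall>\<^sub>F s in E. (\<Sum>a<N. (f a (\<gamma> s) / (\<rho> (\<gamma> s))\<^sup>2) * momentum (Z a) s) = momentum Y s"
      using \<rho>E IE
    proof eventually_elim
      case (elim s)
      have "(\<Sum>a<N. f a (\<gamma> s) * momentum (Z a) s) / (\<rho> (\<gamma> s))\<^sup>2 = momentum Y s"
        unfolding f(2)[rule_format, OF elim(2), symmetric] using elim(1) by simp
      then show ?case by (simp add: sum_divide_distrib)
    qed
    ultimately show ?thesis by (simp cong: landau_o.big.in_cong)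
  qed
  have "\<exists>D. (\<forall>t\<in>I. (momentum X has_real_derivative D t) (at t within I)) \<and> D \<in> O[E](\<Phi>)" if X: "X \<in> F" for X
  proof -
    obtain M \<omega> Y where *: "\<And>i. i < (M::nat) \<Longrightarrow> \<omega> i \<in> one_forms A" "\<And>i. i < M \<Longrightarrow> Y i \<in> F"
      "\<And>t. t \<in> I \<Longrightarrow> (momentum X has_real_derivative
        (\<Sum>i<M. \<omega> i (\<gamma> t) (velocity A I \<gamma> t) * momentum (Y i) t) / 2) (at t within I)"
      by (rule module_momentum_deriv[OF M X]) (rule that)
    have "(\<lambda>t. \<Sum>i<M. \<omega> i (\<gamma> t) (velocity A I \<gamma> t) * momentum (Y i) t) \<in> O[E](\<Phi>)"
      using landau_o.big.mult[OF O1[OF tends_E[OF one_form_velocity_tendsto[OF *(1) t\<^sub>0]]] mom_O[OF *(2)]]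
      by (intro big_sum_in_bigo) simp
    then show ?thesis using *(3) by (intro exI[of _ "\<lambda>t. (\<Sum>i<M. \<omega> i (\<gamma> t) (velocity A I \<gamma> t) * momentum (Y i) t) / 2"]) simp
  qed
  then have "\<forall>a. \<exists>D. a < N \<longrightarrow>
      (\<forall>t\<in>I. (momentum (Z a) has_real_derivative D t) (at t within I)) \<and> D \<in> O[E](\<Phi>)"
    using Z by blast
  from choice[OF this]
  obtain D where D: "\<And>a t. a < N \<Longrightarrow> t \<in> I \<Longrightarrow> (momentum (Z a) has_real_derivative D a t) (at t within I)"
    "\<And>a. a < N \<Longrightarrow> D a \<in> O[E](\<Phi>)" by blast
  have "\<exists>k. k > 0 \<and> (\<forall>\<^sub>F s in E. \<bar>D a s\<bar> \<le> k * \<Phi> s)" if "a < N" for a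
    using D(2)[OF that] by (elim landau_o.bigE) (auto simp: \<Phi>_def sum_nonneg)
  then have "\<forall>a. \<exists>k. a < N \<longrightarrow> k > 0 \<and> (\<forall>\<^sub>F s in E. \<bar>D a s\<bar> \<le> k * \<Phi> s)" by blast
  from choice[OF this]
  obtain k where k: "\<And>a. a < N \<Longrightarrow> k a > 0" "\<And>a. a < N \<Longrightarrow> \<forall>\<^sub>F s in E. \<bar>D a s\<bar> \<le> k a * \<Phi> s"
    by blast
  \<comment> \<open>All \<open>k a\<close> are positive, so their sum bounds each of them.\<close>
  define K where "K = (\<Sum>a<N. k a)"
  have "\<forall>\<^sub>F s in E. \<bar>D a s\<bar> \<le> K * \<Phi> s" if a: "a < N" for a
    using k(2)[OF a]
  proof eventually_elim
    case (elim s)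
    have "k a \<le> K" unfolding K_def by (rule member_le_sum) (use a k(1) in \<open>auto simp: less_imp_le\<close>)
    then have "k a * \<Phi> s \<le> K * \<Phi> s" by (intro mult_right_mono) (auto simp: \<Phi>_def sum_nonneg)
    with elim show ?case by linarith
  qed
  then have "\<forall>\<^sub>F s in E. \<forall>a\<in>{..<N}. \<bar>D a s\<bar> \<le> K * \<Phi> s"
    by (intro eventually_ball_finite) auto
  with \<rho>E have "\<forall>\<^sub>F s in E. \<rho> (\<gamma> s) \<noteq> 0 \<and> (\<forall>a\<in>{..<N}. \<bar>D a s\<bar> \<le> K * \<Phi> s)"
    by eventually_elim simp
  then obtain e where e: "e > 0" "\<And>s. s \<in> I \<Longrightarrow> dist s t\<^sub>0 < e \<Longrightarrow> \<rho> (\<gamma> s) \<noteq> 0"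
    "\<And>s a. s \<in> I \<Longrightarrow> dist s t\<^sub>0 < e \<Longrightarrow> a < N \<Longrightarrow> \<bar>D a s\<bar> \<le> K * \<Phi> s"
    unfolding E_def eventually_inf_principal eventually_nhds_metric by auto
  \<comment> \<open>A ball in the reals is an interval, hence so is \<open>J\<close>, as
    \<open>linear_ode_unique_zero\<close> requires; an end point of \<open>I\<close> may belong to
    it.\<close>
  define J where "J = I \<inter> ball t\<^sub>0 e"
  have "openin (top_of_set I) J" unfolding J_def by (simp add: openin_open_Int)
  moreover have "t\<^sub>0 \<in> J" using t\<^sub>0 e by (simp add: J_def)
  moreover have "momentum Y t = 0" if st: "s \<in> J" "t \<in> J" and zero: "\<forall>Y\<in>F. momentum Y s = 0" and Y: "Y \<in> F" for s t Y
  proof -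
    have J: "is_interval J"
      using geo unfolding J_def geodesic_def by (intro is_interval_Int is_interval_ball_real) auto
    have "momentum (Z a) t = 0" if a: "a \<in> {..<N}" for a
    proof (rule linear_ode_unique_zero[OF J st, of "{..<N}" "\<lambda>a. momentum (Z a)"])
      show "(momentum (Z a) has_real_derivative D a s) (at s within J)" if "a \<in> {..<N}" "s \<in> J" for a s
        using has_field_derivative_subset[OF D(1)] that by (auto simp: J_def)
      show "\<bar>D a s\<bar> \<le> K * (\<Sum>b<N. \<bar>momentum (Z b) s\<bar>)" if "a \<in> {..<N}" "s \<in> J" for a s
        using e(3)[of s a] that by (simp add: J_def \<Phi>_def dist_commute)
    qed (use zero Z a in auto)
    \<comment> \<open>Back from the generators to an arbitrary \<open>Y\<close>: the right-hand side
      vanishes at \<open>t\<close>, and the factor \<open>(\<rho> (\<gamma> t))\<^sup>2\<close> can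
      be cancelled.\<close>
    moreover obtain f where "(\<rho> (\<gamma> t))\<^sup>2 * momentum Y t = (\<Sum>a<N. f a (\<gamma> t) * momentum (Z a) t)"
      using gen'[OF Y] st by (auto simp: J_def)
    moreover have "\<rho> (\<gamma> t) \<noteq> 0" using e(2)[of t] st by (simp add: J_def dist_commute)
    ultimately show ?thesis by simp
  qed
  ultimately show ?thesis by blast
qed

end

theorem proposition3p7:
  fixes A :: "('a::{t2_space, second_countable_topology}, 'e::{real_inner, heine_borel}) chart set"
    and g :: "('a, 'e) bilinear_field"
    and F :: "('a, 'e) vfield set"
  assumes "smooth_atlas A"
    and "module_SRF A g F"
  shows "geometric_SRF A g F"
proof -
  have rm: "riemannian_metric A g" "singular_foliation A F"
    using assms(2) by (auto simp: module_SRF_def)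
  have "g (\<gamma> t) (velocity A I \<gamma> t) w = 0"
    if geo: "geodesic A g I \<gamma>" and t\<^sub>0: "t\<^sub>0 \<in> I"
      and perp: "\<forall>w\<in>leaf_tangent F (\<gamma> t\<^sub>0). g (\<gamma> t\<^sub>0) (velocity A I \<gamma> t\<^sub>0) w = 0"
      and t: "t \<in> I" and w: "w \<in> leaf_tangent F (\<gamma> t)" for I \<gamma> t\<^sub>0 t w
  proof -
    interpret riemannian_geodesic A g I \<gamma>
      by unfold_locales (fact assms(1) rm(1) geo)+
    have "connected I" using geo by (simp add: geodesic_def is_interval_connected)
    moreover have "\<forall>Y\<in>F. momentum Y t\<^sub>0 = 0" using perp by (auto simp: leaf_tangent_def)
    ultimately have "\<forall>Y\<in>F. momentum Y t = 0"
      using module_momentum_locally_zero[OF assms(2)]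
      by (rule connected_induction_simple[OF _ t\<^sub>0 t, where P = "\<lambda>t. \<forall>Y\<in>F. momentum Y t = 0"])
    then show ?thesis using w by (auto simp: leaf_tangent_def)
  qed
  then show ?thesis using rm unfolding geometric_SRF_def by blast
qed

end
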